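(* Let $(X,d)$ be a compact metric space and $x\in X$. (a) Let $\{T^w\}_{w\in\widetilde L(\Sigma,\vec k)}$ be an $\widetilde L(\Sigma,\vec k)$-system of $X$ and $\vec w\in\widetilde L^\infty(\Sigma,\vec k;\upsilon)$. Then there exist an extraction $\vec u\prec\vec w$ and $x_0\in X$ such that $R_1\text{-}\lim_{w\in\widetilde E(\vec u)}T^w(x)=x_0$ and moreover $R_1\text{-}\lim_{w\in\widetilde E(\vec u)}T^w(x_0)=x_0$. (b) Let $\{T^w\}_{w\in L(\Sigma,\vec k)}$ be an $L(\Sigma,\vec k)$-system of $X$ and $\vec w\in L^\infty(\Sigma,\vec k;\upsilon)$. Then there exist an extraction $\vec u\prec\vec w$ and $x_0\in X$ such that $R_2\text{-}\lim_{w\in E(\vec u)}T^w(x)=x_0$ and moreover $R_2\text{-}\lim_{w\in E(\vec u)}T^w(x_0)=x_0$.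
   Context: Notation: $\mathbb{N}=\{1,2,\ldots\}$, $\mathbb{Z}^\ast=\mathbb{Z}\setminus\{0\}$. $\Sigma=\{\alpha_n:n\in\mathbb{Z}^\ast\}$ is an alphabet (letters need not be distinct), $\vec k=(k_n)_{n\in\mathbb{Z}^\ast}\subseteq\mathbb{N}$ with $(k_n)_{n\in\mathbb{N}}$ and $(k_{-n})_{n\in\mathbb{N}}$ increasing in the weak sense (constant sequences allowed), and $\upsilon\notin\Sigma$ is a variable. Two-sided words. $\widetilde L(\Sigma,\vec k)$ is the set of functions $w$ from a nonempty finite set $dom(w)\subset\mathbb{Z}^\ast$ to $\Sigma$ with $w(n)\in\{\alpha_1,\ldots,\alpha_{k_n}\}$ for $n\in dom(w)$, $n>0$, and $w(n)\in\{\alpha_{-k_n},\ldots,\alpha_{-1}\}$ for $n\in dom(w)$, $n<0$. A variable word is a function $w$ from a nonempty finite $dom(w)\subset\mathbb{Z}^\ast$ to $\Sigma\cup\{\upsilon\}$ such that, for each $n\in dom(w)$, $w(n)\in\{\upsilon,\alpha_1,\ldots,\alpha_{k_n}\}$ if $n>0$ and $w(n)\in\{\upsilon,\alpha_{-k_n},\ldots,\alpha_{-1}\}$ if $n<0$, and $\upsilon$ is attained. $dom^-(w)$, $dom^+(w)$ are the sets of negative, respectively positive, elements of $dom(w)$. $\widetilde L_0(\Sigma,\vec k;\upsilon)$ is the set of variable words taking the value $\upsilon$ at some negative and at some positive position. For words $w,u$ (variable or not) with disjoint domains, $w\star u$ is the word with domain $dom(w)\cup dom(u)$ extending both. $w<_{R_1}u$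 means $dom(u)=A_1\cup A_2$ with $A_1,A_2\ne\emptyset$ and $\max A_1<\min dom(w)\le\max dom(w)<\min A_2$. $\widetilde L^\infty(\Sigma,\vec k;\upsilon)$ is the set of sequences $(w_n)_{n\in\mathbb{N}}$ in $\widetilde L_0(\Sigma,\vec k;\upsilon)$ with $w_n<_{R_1}w_{n+1}$ for all $n$. Substitution: for $w\in\widetilde L_0(\Sigma,\vec k;\upsilon)$ with $n_w=\min dom^+(w)$, $-m_w=\max dom^-(w)$, and $1\le p\le k_{n_w}$, $1\le q\le k_{-m_w}$, $w(p,q)$ is obtained from $w$ by replacing $\upsilon$ by $\alpha_p$ at positive positions and by $\alpha_{-q}$ at negative positions; $w(\upsilon,\upsilon)=w$. Extractions: for $\vec w=(w_n)\in\widetilde L^\infty(\Sigma,\vec k;\upsilon)$, $\widetilde E(\vec w)$ is the set of words $w_{n_1}(p_1,q_1)\star\cdots\star w_{n_\lambda}(p_\lambda,q_\lambda)$ with $\lambda\in\mathbb{N}$, $n_1<\cdots<n_\lambda$ in $\mathbb{N}$, $(p_i,q_i)\in\{1,\ldots,k_{n_i}\}\times\{1,\ldots,k_{-n_i}\}$. $\widetilde{EV}(\vec w)$ is the set of words of the same form where $(p_i,q_i)\in(\{1,\ldots,k_{n_i}\}\times\{1,\ldots,k_{-n_i}\})\cup\{(\upsilon,\upsilon)\}$ and at least one $(p_i,q_i)=(\upsilon,\upsilon)$. $\vec u\prec\vec w$ ("$\vec u$ is an extraction of $\vec w$") means $\vec u\in\widetilde L^\infty(\Sigma,\vec k;\upsilon)$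 and $u_n\in\widetilde{EV}(\vec w)$ for all $n$. One-sided words. $L(\Sigma,\vec k)$ is the set of $w\in\widetilde L(\Sigma,\vec k)$ with $dom(w)\subset\mathbb{N}$; $L(\Sigma,\vec k;\upsilon)$ is the set of variable words with domain in $\mathbb{N}$. $w<_{R_2}u$ means $\max dom(w)<\min dom(u)$. $L^\infty(\Sigma,\vec k;\upsilon)$ is the set of sequences $(w_n)_{n\in\mathbb{N}}$ in $L(\Sigma,\vec k;\upsilon)$ with $w_n<_{R_2}w_{n+1}$. For $1\le p\le k_{\min dom(w)}$, $w(p)$ is $w$ with $\upsilon$ replaced by $\alpha_p$; $w(\upsilon)=w$. $E(\vec w)$ is the set of words $w_{n_1}(p_1)\star\cdots\star w_{n_\lambda}(p_\lambda)$ with $n_1<\cdots<n_\lambda$, $1\le p_i\le k_{n_i}$; $EV(\vec w)$ is the same with $p_i\in\{1,\ldots,k_{n_i}\}\cup\{\upsilon\}$ and some $p_i=\upsilon$. $\vec u\prec\vec w$ means $\vec u\in L^\infty(\Sigma,\vec k;\upsilon)$ and $u_n\in EV(\vec w)$ for all $n$. Convergence. $R_1\text{-}\lim_{w\in\widetilde E(\vec u)}x_w=x_0$ means: for every neighborhood $V$ of $x_0$ there is $n_0\in\mathbb{N}$ with $x_w\in V$ for all $w\in\widetilde E(\vec u)$ with $\min\{-\max dom^-(w),\min dom^+(w)\}\ge n_0$. $R_2\text{-}\lim_{w\in E(\vec u)}x_w=x_0$ means the same with $w\in E(\vec u)$ and $\min dom(w)\ge n_0$. Systems. An $\widetilde L(\Sigma,\vec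 k)$-system (resp. $L(\Sigma,\vec k)$-system) of a topological space $X$ is a family $\{T^w\}$ of continuous maps $X\to X$ indexed by $w\in\widetilde L(\Sigma,\vec k)$ (resp. $w\in L(\Sigma,\vec k)$) with $T^{w_1}T^{w_2}=T^{w_1\star w_2}$ whenever $w_1<_{R_1}w_2$ (resp. $w_1<_{R_2}w_2$). *)

theory Defs
  imports "HOL-Analysis.Analysis"
begin

text \<open>
  A word is a partial function on the integers with values in a type of symbols. The alphabet is
  the family \<open>\<alpha>\<close>, indexed by the nonzero integers, and the variable \<open>\<upsilon>\<close> is a further symbol.
  The values \<open>\<alpha> 0\<close> and \<open>k 0\<close> are never used. The natural numbers of the source start at 1, so
  a sequence is a function on \<^typ>\<open>nat\<close> whose value at 0 is ignored.
\<close>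

type_synonym 'a word_map = "int \<rightharpoonup> 'a"

definition alphabet_setup :: "(int \<Rightarrow> 'a) \<Rightarrow> (int \<Rightarrow> nat) \<Rightarrow> 'a \<Rightarrow> bool" where
  "alphabet_setup \<alpha> k \<upsilon> \<longleftrightarrow>
     (\<forall>n. n \<noteq> 0 \<longrightarrow> 1 \<le> k n) \<and>
     (\<forall>m n. 0 < m \<and> m \<le> n \<longrightarrow> k m \<le> k n \<and> k (- m) \<le> k (- n)) \<and>
     \<upsilon> \<notin> \<alpha> ` {n. n \<noteq> 0}"

definition letters_at :: "(int \<Rightarrow> 'a) \<Rightarrow> (int \<Rightarrow> nat) \<Rightarrow> int \<Rightarrow> 'a set" where
  "letters_at \<alpha> k n = (if n > 0 then \<alpha> ` {1..int (k n)} else \<alpha> ` {- int (k n)..-1})"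


subsection \<open>Words\<close>

definition words2 :: "(int \<Rightarrow> 'a) \<Rightarrow> (int \<Rightarrow> nat) \<Rightarrow> 'a word_map set" where
  "words2 \<alpha> k = {w. finite (dom w) \<and> dom w \<noteq> {} \<and> 0 \<notin> dom w \<and>
     (\<forall>n\<in>dom w. the (w n) \<in> letters_at \<alpha> k n)}"

definition vwords :: "(int \<Rightarrow> 'a) \<Rightarrow> (int \<Rightarrow> nat) \<Rightarrow> 'a \<Rightarrow> 'a word_map set" where
  "vwords \<alpha> k \<upsilon> = {w. finite (dom w) \<and> dom w \<noteq> {} \<and> 0 \<notin> dom w \<and>
     (\<forall>n\<in>dom w. the (w n) \<in> insert \<upsilon> (letters_at \<alpha> k n)) \<and> \<upsilon> \<in> ran w}"

definition dom_neg :: "'a word_map \<Rightarrow> int set" where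
  "dom_neg w = {n \<in> dom w. n < 0}"

definition dom_pos :: "'a word_map \<Rightarrow> int set" where
  "dom_pos w = {n \<in> dom w. n > 0}"

definition vwords2 :: "(int \<Rightarrow> 'a) \<Rightarrow> (int \<Rightarrow> nat) \<Rightarrow> 'a \<Rightarrow> 'a word_map set" where
  "vwords2 \<alpha> k \<upsilon> = {w \<in> vwords \<alpha> k \<upsilon>.
     (\<exists>n\<in>dom_neg w. w n = Some \<upsilon>) \<and> (\<exists>n\<in>dom_pos w. w n = Some \<upsilon>)}"

definition words1 :: "(int \<Rightarrow> 'a) \<Rightarrow> (int \<Rightarrow> nat) \<Rightarrow> 'a word_map set" where
  "words1 \<alpha> k = {w \<in> words2 \<alpha> k. dom w \<subseteq> {1..}}"

definition vwords1 :: "(int \<Rightarrow> 'a) \<Rightarrow> (int \<Rightarrow> nat) \<Rightarrow> 'a \<Rightarrow> 'a word_map set" where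
  "vwords1 \<alpha> k \<upsilon> = {w \<in> vwords \<alpha> k \<upsilon>. dom w \<subseteq> {1..}}"

definition R1_less :: "'a word_map \<Rightarrow> 'a word_map \<Rightarrow> bool" where
  "R1_less w u \<longleftrightarrow> (\<exists>A1 A2. dom u = A1 \<union> A2 \<and> A1 \<noteq> {} \<and> A2 \<noteq> {} \<and>
     Max A1 < Min (dom w) \<and> Min (dom w) \<le> Max (dom w) \<and> Max (dom w) < Min A2)"

definition R2_less :: "'a word_map \<Rightarrow> 'a word_map \<Rightarrow> bool" where
  "R2_less w u \<longleftrightarrow> Max (dom w) < Min (dom u)"

definition seqs2 :: "(int \<Rightarrow> 'a) \<Rightarrow> (int \<Rightarrow> nat) \<Rightarrow> 'a \<Rightarrow> (nat \<Rightarrow> 'a word_map) set" where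
  "seqs2 \<alpha> k \<upsilon> = {w. \<forall>n\<ge>1. w n \<in> vwords2 \<alpha> k \<upsilon> \<and> R1_less (w n) (w (Suc n))}"

definition seqs1 :: "(int \<Rightarrow> 'a) \<Rightarrow> (int \<Rightarrow> nat) \<Rightarrow> 'a \<Rightarrow> (nat \<Rightarrow> 'a word_map) set" where
  "seqs1 \<alpha> k \<upsilon> = {w. \<forall>n\<ge>1. w n \<in> vwords1 \<alpha> k \<upsilon> \<and> R2_less (w n) (w (Suc n))}"

text \<open>
  The concatenation \<open>\<star>\<close>, which the source uses for words with disjoint domains only, is
  the map sum \<open>++\<close>. \<open>stars [w\<^sub>1, \<dots>, w\<^sub>n]\<close> is \<open>w\<^sub>1 \<star> \<dots> \<star> w\<^sub>n\<close>.
\<close>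

definition stars :: "'a word_map list \<Rightarrow> 'a word_map" where
  "stars ws = foldr (++) ws Map.empty"


subsection \<open>Substitution and extractions\<close>

text \<open>
  A substitution parameter is \<open>Some (p, q)\<close> (resp. \<open>Some p\<close>) for numerical values and \<open>None\<close> for
  \<open>(\<upsilon>, \<upsilon>)\<close> (resp. \<open>\<upsilon>\<close>). The source restricts \<open>w(p, q)\<close> to \<open>1 \<le> p \<le> k n\<close> and \<open>1 \<le> q \<le> k (- m)\<close>,
  where \<open>n = min dom\<^sup>+(w)\<close> and \<open>- m = max dom\<^sup>-(w)\<close>. In extractions the parameters are bounded by the
  values of \<open>k\<close> at the index of the word in its sequence. This is at most \<open>n\<close> and at most \<open>m\<close>, so
  these restrictions hold there by monotonicity of \<open>k\<close>; likewise for one-sided words.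
\<close>

fun subst2 :: "(int \<Rightarrow> 'a) \<Rightarrow> 'a \<Rightarrow> 'a word_map \<Rightarrow> (nat \<times> nat) option \<Rightarrow> 'a word_map" where
  "subst2 \<alpha> \<upsilon> w None = w"
| "subst2 \<alpha> \<upsilon> w (Some (p, q)) = (\<lambda>n. if w n = Some \<upsilon>
     then Some (if n > 0 then \<alpha> (int p) else \<alpha> (- int q)) else w n)"

fun subst1 :: "(int \<Rightarrow> 'a) \<Rightarrow> 'a \<Rightarrow> 'a word_map \<Rightarrow> nat option \<Rightarrow> 'a word_map" where
  "subst1 \<alpha> \<upsilon> w None = w"
| "subst1 \<alpha> \<upsilon> w (Some p) = (\<lambda>n. if w n = Some \<upsilon> then Some (\<alpha> (int p)) else w n)"

definition params2 :: "(int \<Rightarrow> nat) \<Rightarrow> nat \<Rightarrow> (nat \<times> nat) option set" where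
  "params2 k n = Some ` ({1..k (int n)} \<times> {1..k (- int n)})"

definition params1 :: "(int \<Rightarrow> nat) \<Rightarrow> nat \<Rightarrow> nat option set" where
  "params1 k n = Some ` {1..k (int n)}"

text \<open>
  The list \<open>ns\<close> is \<open>n\<^sub>1 < \<dots> < n\<^sub>\<lambda>\<close>. As its entries are distinct, the parameters are given by a
  function \<open>c\<close> of \<open>n\<^sub>i\<close> instead of \<open>i\<close>.
\<close>

definition Ext2 ::
  "(int \<Rightarrow> 'a) \<Rightarrow> (int \<Rightarrow> nat) \<Rightarrow> 'a \<Rightarrow> (nat \<Rightarrow> 'a word_map) \<Rightarrow> 'a word_map set" where
  "Ext2 \<alpha> k \<upsilon> w = {stars (map (\<lambda>n. subst2 \<alpha> \<upsilon> (w n) (c n)) ns) | ns c.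
     ns \<noteq> [] \<and> sorted_wrt (<) ns \<and> (\<forall>n\<in>set ns. 1 \<le> n \<and> c n \<in> params2 k n)}"

definition ExtV2 ::
  "(int \<Rightarrow> 'a) \<Rightarrow> (int \<Rightarrow> nat) \<Rightarrow> 'a \<Rightarrow> (nat \<Rightarrow> 'a word_map) \<Rightarrow> 'a word_map set" where
  "ExtV2 \<alpha> k \<upsilon> w = {stars (map (\<lambda>n. subst2 \<alpha> \<upsilon> (w n) (c n)) ns) | ns c.
     ns \<noteq> [] \<and> sorted_wrt (<) ns \<and> (\<forall>n\<in>set ns. 1 \<le> n \<and> c n \<in> insert None (params2 k n)) \<and>
     (\<exists>n\<in>set ns. c n = None)}"

definition Ext1 ::
  "(int \<Rightarrow> 'a) \<Rightarrow> (int \<Rightarrow> nat) \<Rightarrow> 'a \<Rightarrow> (nat \<Rightarrow> 'a word_map) \<Rightarrow> 'a word_map set" where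
  "Ext1 \<alpha> k \<upsilon> w = {stars (map (\<lambda>n. subst1 \<alpha> \<upsilon> (w n) (c n)) ns) | ns c.
     ns \<noteq> [] \<and> sorted_wrt (<) ns \<and> (\<forall>n\<in>set ns. 1 \<le> n \<and> c n \<in> params1 k n)}"

definition ExtV1 ::
  "(int \<Rightarrow> 'a) \<Rightarrow> (int \<Rightarrow> nat) \<Rightarrow> 'a \<Rightarrow> (nat \<Rightarrow> 'a word_map) \<Rightarrow> 'a word_map set" where
  "ExtV1 \<alpha> k \<upsilon> w = {stars (map (\<lambda>n. subst1 \<alpha> \<upsilon> (w n) (c n)) ns) | ns c.
     ns \<noteq> [] \<and> sorted_wrt (<) ns \<and> (\<forall>n\<in>set ns. 1 \<le> n \<and> c n \<in> insert None (params1 k n)) \<and>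
     (\<exists>n\<in>set ns. c n = None)}"

definition extraction2 ::
  "(int \<Rightarrow> 'a) \<Rightarrow> (int \<Rightarrow> nat) \<Rightarrow> 'a \<Rightarrow> (nat \<Rightarrow> 'a word_map) \<Rightarrow> (nat \<Rightarrow> 'a word_map) \<Rightarrow> bool" where
  "extraction2 \<alpha> k \<upsilon> u w \<longleftrightarrow> u \<in> seqs2 \<alpha> k \<upsilon> \<and> (\<forall>n\<ge>1. u n \<in> ExtV2 \<alpha> k \<upsilon> w)"

definition extraction1 ::
  "(int \<Rightarrow> 'a) \<Rightarrow> (int \<Rightarrow> nat) \<Rightarrow> 'a \<Rightarrow> (nat \<Rightarrow> 'a word_map) \<Rightarrow> (nat \<Rightarrow> 'a word_map) \<Rightarrow> bool" where
  "extraction1 \<alpha> k \<upsilon> u w \<longleftrightarrow> u \<in> seqs1 \<alpha> k \<upsilon> \<and> (\<forall>n\<ge>1. u n \<in> ExtV1 \<alpha> k \<upsilon> w)"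


subsection \<open>Convergence and systems\<close>

definition R1_lim :: "'a word_map set \<Rightarrow> ('a word_map \<Rightarrow> 'x::topological_space) \<Rightarrow> 'x \<Rightarrow> bool" where
  "R1_lim E f x0 \<longleftrightarrow> (\<forall>V. open V \<and> x0 \<in> V \<longrightarrow> (\<exists>n0\<ge>1::nat. \<forall>w\<in>E.
     min (- Max (dom_neg w)) (Min (dom_pos w)) \<ge> int n0 \<longrightarrow> f w \<in> V))"

definition R2_lim :: "'a word_map set \<Rightarrow> ('a word_map \<Rightarrow> 'x::topological_space) \<Rightarrow> 'x \<Rightarrow> bool" where
  "R2_lim E f x0 \<longleftrightarrow> (\<forall>V. open V \<and> x0 \<in> V \<longrightarrow> (\<exists>n0\<ge>1::nat. \<forall>w\<in>E.
     Min (dom w) \<ge> int n0 \<longrightarrow> f w \<in> V))"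

text \<open>
  The space \<open>X\<close> is a set in a topological type, with the subspace topology. The value \<open>T w\<close> matters
  only for words \<open>w\<close> of the index set, and only on \<open>X\<close>.
\<close>

definition system2 :: "(int \<Rightarrow> 'a) \<Rightarrow> (int \<Rightarrow> nat) \<Rightarrow> 'x::topological_space set \<Rightarrow>
    ('a word_map \<Rightarrow> 'x \<Rightarrow> 'x) \<Rightarrow> bool" where
  "system2 \<alpha> k X T \<longleftrightarrow>
     (\<forall>w\<in>words2 \<alpha> k. continuous_on X (T w) \<and> T w ` X \<subseteq> X) \<and>
     (\<forall>w1\<in>words2 \<alpha> k. \<forall>w2\<in>words2 \<alpha> k. R1_less w1 w2 \<longrightarrow>
        (\<forall>y\<in>X. T w1 (T w2 y) = T (w1 ++ w2) y))"

definition system1 :: "(int \<Rightarrow> 'a) \<Rightarrow> (int \<Rightarrow> nat) \<Rightarrow> 'x::topological_space set \<Rightarrow>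
    ('a word_map \<Rightarrow> 'x \<Rightarrow> 'x) \<Rightarrow> bool" where
  "system1 \<alpha> k X T \<longleftrightarrow>
     (\<forall>w\<in>words1 \<alpha> k. continuous_on X (T w) \<and> T w ` X \<subseteq> X) \<and>
     (\<forall>w1\<in>words1 \<alpha> k. \<forall>w2\<in>words1 \<alpha> k. R2_less w1 w2 \<longrightarrow>
        (\<forall>y\<in>X. T w1 (T w2 y) = T (w1 ++ w2) y))"

end

theory Submission
  imports Defs
begin

text \<open>
  Words in \<open>E(w)\<close> and \<open>EV(w)\<close> are given by finite partial functions from indices to parameters or
  the variable, and these form a semigroup under \<open>++\<close>. Among its ultrafilters there are an idempotent
  \<open>q\<close> of words without variable, minimal among such idempotents, and an ultrafilter \<open>r\<close> of variable
  words that every substitution maps to \<open>q\<close>. By compactness \<open>T w x\<close> converges to some \<open>x0\<close> along \<open>q\<close>.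
  As in the ultrafilter proof of Hindman's theorem, variable words \<open>u 1, u 2, \<dots>\<close> are picked from \<open>r\<close>
  such that the products of their values from index \<open>n\<close> on lie in \<open>{w. dist (T w x) x0 < 1 / n}\<close>.
  Finally \<open>T v x0\<close> is the limit of \<open>T v (T v' x) = T (v \<star> v') x\<close> as \<open>v'\<close> moves away, hence close
  to \<open>x0\<close> as well.
\<close>

subsection \<open>Ultrafilters on a semigroup\<close>

text \<open>Both cases are reduced to words over the indices of the given sequence, with one letter
  for each parameter; signs and positions return only when such words are realized as products. Two
  obstacles shape the argument. The operation \<open>++\<close> is total, but it behaves like
  \<open>\<star>\<close> only when the right factor does not override the left one, and a parameter
  admissible at index \<open>n\<close> need not be admissible at smaller indices. Both are overcome
  by ultrafilters that contain all tails: for them the right factor is eventually beyond any given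
  left factor, and any given parameter is eventually admissible. A variable word has to be chosen
  before its parameter is known, so all its values must be large for the same ultrafilter. At a
  single index these are finitely many conditions, but over all indices there may be infinitely many
  parameters. The minimality of \<open>q\<close> is what forces the images of \<open>r\<close> under
  all of them to coincide.\<close>

definition ultra :: "'a filter \<Rightarrow> bool" where
  "ultra U \<longleftrightarrow> U \<noteq> bot \<and> (\<forall>P. eventually P U \<or> eventually (\<lambda>x. \<not> P x) U)"

lemma ultra_not: "ultra U \<Longrightarrow> eventually (\<lambda>x. \<not> P x) U \<longleftrightarrow> \<not> eventually P U"
  using eventually_conj[of P U "\<lambda>x. \<not> P x"] by (auto simp: ultra_def trivial_limit_def)

text \<open>Finer filters are smaller, so ultrafilters are the atoms: a set in \<open>V\<close> but
  not in \<open>U\<close> would have its complement in \<open>U\<close>, hence in \<open>V\<close>,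
  and \<open>V\<close> would be \<open>bot\<close>.\<close>

lemma ultra_le_eq:
  assumes "ultra U" "V \<le> U" "V \<noteq> bot"
  shows "V = U"
proof (rule antisym[OF assms(2)])
  show "U \<le> V"
    unfolding le_filter_def
  proof (intro allI impI)
    fix P assume P: "eventually P V"
    show "eventually P U"
    proof (rule ccontr)
      assume "\<not> eventually P U"
      then have "eventually (\<lambda>x. \<not> P x) V"
        using assms ultra_not[of U P] by (auto simp: le_filter_def)
      with P have "eventually (\<lambda>x. False) V" by eventually_elim simp
      with assms(3) show False by (simp add: trivial_limit_def)
    qed
  qed
qed

lemma ultra_not_bot: "ultra U \<Longrightarrow> U \<noteq> bot"
  by (simp add: ultra_def)

lemma ultra_filtermap: "ultra U \<Longrightarrow> ultra (filtermap f U)"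
  unfolding ultra_def by (auto simp: eventually_filtermap filtermap_bot_iff)

text \<open>Zorn's lemma in the descending direction. \<open>Q\<close> is taken to be properness,
  being a closed subsemigroup, and being a closed left ideal.\<close>

lemma minimal_filter:
  fixes F :: "'a filter"
  assumes "Q F"
    and chain: "\<And>C. \<lbrakk>C \<noteq> {}; \<forall>A\<in>C. \<forall>B\<in>C. A \<le> B \<or> B \<le> A; \<forall>A\<in>C. Q A\<rbrakk> \<Longrightarrow> Q (Inf C)"
  obtains M where "M \<le> F" "Q M" "\<And>G. G \<le> M \<Longrightarrow> Q G \<Longrightarrow> G = M"
proof -
  let ?A = "{G. G \<le> F \<and> Q G}"
  have po: "partial_order_on ?A (relation_of (\<ge>) ?A)"
    by (rule partial_order_on_relation_ofI) auto
  have "\<exists>m\<in>?A. \<forall>a\<in>?A. m \<ge> a \<longrightarrow> a = m"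
  proof (rule predicate_Zorn[OF po])
    fix C assume C: "C \<in> Chains (relation_of (\<ge>) ?A)"
    then have sub: "C \<subseteq> ?A" and lin: "\<forall>A\<in>C. \<forall>B\<in>C. A \<le> B \<or> B \<le> A"
      by (auto simp: Chains_def relation_of_def)
    show "\<exists>u\<in>?A. \<forall>a\<in>C. a \<ge> u"
    proof (cases "C = {}")
      case True
      with assms(1) show ?thesis by auto
    next
      case False
      with chain[OF False lin] sub have "Q (Inf C)" by auto
      moreover obtain A where "A \<in> C" using False by auto
      then have "Inf C \<le> F" using sub by (intro order_trans[OF Inf_lower[of A C]]) auto
      ultimately show ?thesis by (auto intro: Inf_lower)
    qed
  qed
  then obtain m where "m \<le> F" "Q m" "\<forall>a. a \<le> F \<and> Q a \<longrightarrow> a \<le> m \<longrightarrow> a = m" by auto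
  with that[of m] show ?thesis by (auto intro: order_trans)
qed

text \<open>This is compactness of the space of ultrafilters: the infimum of a chain of filters is
  their union as families of sets, and a union of proper filters is proper.\<close>

lemma Inf_chain_not_bot:
  fixes C :: "'a filter set"
  assumes "C \<noteq> {}" "\<forall>A\<in>C. \<forall>B\<in>C. A \<le> B \<or> B \<le> A" "\<forall>A\<in>C. A \<noteq> bot"
  shows "Inf C \<noteq> bot"
proof -
  have "eventually P (Inf C) \<longleftrightarrow> (\<exists>b\<in>C. eventually P b)" for P
    by (rule eventually_Inf_base[OF assms(1)]) (metis assms(2) inf_absorb1 inf_absorb2 order_refl)
  then show ?thesis using assms(3) by (simp add: trivial_limit_def)
qed

text \<open>A minimal proper filter is an ultrafilter, since adjoining a set to it gives either
  \<open>bot\<close> or the filter itself.\<close>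

lemma ultra_exists:
  assumes "F \<noteq> bot"
  obtains U where "ultra U" "U \<le> F"
proof -
  obtain M where M: "M \<le> F" "M \<noteq> bot" "\<And>G. G \<le> M \<Longrightarrow> G \<noteq> bot \<Longrightarrow> G = M"
    by (rule minimal_filter[of "\<lambda>F. F \<noteq> bot", OF assms Inf_chain_not_bot]) blast+
  have "eventually P M \<or> eventually (\<lambda>x. \<not> P x) M" for P
  proof (cases "inf M (principal {x. P x}) = bot")
    case True
    then have "eventually (\<lambda>x. False) (inf M (principal {x. P x}))" by simp
    then show ?thesis by (simp add: eventually_inf_principal)
  next
    case False
    then have "inf M (principal {x. P x}) = M" by (intro M(3)) auto
    then have "M \<le> principal {x. P x}" by (simp add: inf.absorb_iff1)
    then show ?thesis by (simp add: le_principal)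
  qed
  with M(1,2) that show ?thesis by (auto simp: ultra_def)
qed

section \<open>Multiplication of ultrafilters\<close>

context semigroup
begin

text \<open>On ultrafilters this is the usual extension of the operation to the Stone-Cech
  compactification. With the quantifiers in this order, right multiplication by a fixed ultrafilter
  is continuous; left multiplication in general is not.\<close>

definition fprod :: "'a filter \<Rightarrow> 'a filter \<Rightarrow> 'a filter" where
  "fprod F G = Abs_filter (\<lambda>P. eventually (\<lambda>s. eventually (\<lambda>t. P (f s t)) G) F)"

lemma eventually_fprod:
  "eventually P (fprod F G) \<longleftrightarrow> eventually (\<lambda>s. eventually (\<lambda>t. P (f s t)) G) F"
  unfolding fprod_def
proof (rule eventually_Abs_filter, rule is_filter.intro)
  fix P Q assume "eventually (\<lambda>s. eventually (\<lambda>t. P (f s t)) G) F" "eventually (\<lambda>s. eventually (\<lambda>t. Q (f s t)) G) F"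
  then show "eventually (\<lambda>s. eventually (\<lambda>t. P (f s t) \<and> Q (f s t)) G) F"
    by eventually_elim (rule eventually_conj)
next
  fix P Q :: "'a \<Rightarrow> bool" assume "\<forall>x. P x \<longrightarrow> Q x" "eventually (\<lambda>s. eventually (\<lambda>t. P (f s t)) G) F"
  then show "eventually (\<lambda>s. eventually (\<lambda>t. Q (f s t)) G) F"
    by (auto elim!: eventually_mono)
qed simp

lemma fprod_assoc: "fprod (fprod F G) H = fprod F (fprod G H)"
  by (simp add: filter_eq_iff eventually_fprod assoc)

lemma fprod_mono: "F \<le> F' \<Longrightarrow> G \<le> G' \<Longrightarrow> fprod F G \<le> fprod F' G'"
  unfolding le_filter_def eventually_fprod by (metis (mono_tags, lifting) eventually_mono)

lemma fprod_not_bot: "F \<noteq> bot \<Longrightarrow> G \<noteq> bot \<Longrightarrow> fprod F G \<noteq> bot"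
  by (simp add: trivial_limit_def eventually_fprod)

lemma ultra_fprod: "ultra U \<Longrightarrow> ultra V \<Longrightarrow> ultra (fprod U V)"
  by (simp add: ultra_def[of "fprod U V"] eventually_fprod fprod_not_bot ultra_not_bot ultra_not)

lemma filtermap_fprod:
  assumes "\<And>s t. h (f s t) = f (h s) (h t)"
  shows "filtermap h (fprod F G) = fprod (filtermap h F) (filtermap h G)"
  by (simp add: filter_eq_iff eventually_fprod eventually_filtermap assms)

text \<open>The largest filter \<open>F\<close> with \<open>fprod F U \<le> G\<close>.\<close>

definition residual :: "'a filter \<Rightarrow> 'a filter \<Rightarrow> 'a filter" where
  "residual G U = Abs_filter (\<lambda>R. \<exists>P. eventually P G \<and> (\<forall>s. eventually (\<lambda>t. P (f s t)) U \<longrightarrow> R s))"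

lemma eventually_residual:
  "eventually R (residual G U) \<longleftrightarrow> (\<exists>P. eventually P G \<and> (\<forall>s. eventually (\<lambda>t. P (f s t)) U \<longrightarrow> R s))"
  unfolding residual_def
proof (rule eventually_Abs_filter, rule is_filter.intro)
  fix R S
  assume "\<exists>P. eventually P G \<and> (\<forall>s. eventually (\<lambda>t. P (f s t)) U \<longrightarrow> R s)"
    and "\<exists>P. eventually P G \<and> (\<forall>s. eventually (\<lambda>t. P (f s t)) U \<longrightarrow> S s)"
  then obtain P P' where "eventually P G \<and> (\<forall>s. eventually (\<lambda>t. P (f s t)) U \<longrightarrow> R s)"
    and "eventually P' G \<and> (\<forall>s. eventually (\<lambda>t. P' (f s t)) U \<longrightarrow> S s)" by blast
  then show "\<exists>P. eventually P G \<and> (\<forall>s. eventually (\<lambda>t. P (f s t)) U \<longrightarrow> R s \<and> S s)"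
    by (intro exI[of _ "\<lambda>x. P x \<and> P' x"]) (simp add: eventually_conj_iff)
qed (auto intro: exI[of _ "\<lambda>_. True"])

lemma le_residual_iff: "F \<le> residual G U \<longleftrightarrow> fprod F U \<le> G"
proof
  assume F: "F \<le> residual G U"
  show "fprod F U \<le> G"
    unfolding le_filter_def eventually_fprod
  proof (intro allI impI)
    fix P assume "eventually P G"
    then have "eventually (\<lambda>s. eventually (\<lambda>t. P (f s t)) U) (residual G U)"
      unfolding eventually_residual by blast
    with F show "eventually (\<lambda>s. eventually (\<lambda>t. P (f s t)) U) F" by (simp add: le_filter_def)
  qed
next
  assume F: "fprod F U \<le> G"
  show "F \<le> residual G U"
    unfolding le_filter_def eventually_residual
  proof (intro allI impI, elim exE conjE)
    fix R P assume "eventually P G" and P: "\<forall>s. eventually (\<lambda>t. P (f s t)) U \<longrightarrow> R s"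
    then have "eventually (\<lambda>s. eventually (\<lambda>t. P (f s t)) U) F"
      using F by (simp add: le_filter_def eventually_fprod)
    then show "eventually R F" by (rule eventually_mono) (use P in blast)
  qed
qed

text \<open>Right multiplication by \<open>U\<close> is continuous, so the image of the closed set
  of \<open>F\<close> is closed, and it is the closed set of \<open>fprod F U\<close>. Concretely,
  \<open>V\<close> may be any ultrafilter below both \<open>F\<close> and
  \<open>residual G U\<close>; if these were incompatible, some \<open>P\<close> in \<open>G\<close>
  would have its complement in \<open>fprod F U\<close>, contrary to
  \<open>G \<le> fprod F U\<close>.\<close>

lemma ultra_le_fprod:
  assumes "ultra U" "ultra G" "G \<le> fprod F U"
  obtains V where "ultra V" "V \<le> F" "fprod V U = G"
proof -
  have "inf F (residual G U) \<noteq> bot"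
  proof
    assume "inf F (residual G U) = bot"
    then have "eventually (\<lambda>x. False) (inf F (residual G U))" by simp
    then obtain Q P where "eventually Q F" and P: "eventually P G"
      and "\<And>s. eventually (\<lambda>t. P (f s t)) U \<Longrightarrow> \<not> Q s"
      unfolding eventually_inf eventually_residual by blast
    then have "eventually (\<lambda>s. \<not> eventually (\<lambda>t. P (f s t)) U) F"
      by (auto elim!: eventually_mono)
    then have "eventually (\<lambda>x. \<not> P x) (fprod F U)"
      by (simp add: eventually_fprod ultra_not[OF assms(1)])
    with assms(3) have "eventually (\<lambda>x. \<not> P x) G" by (simp add: le_filter_def)
    with P show False using ultra_not[OF assms(2)] by blast
  qed
  then obtain V where V: "ultra V" "V \<le> inf F (residual G U)" by (rule ultra_exists)
  then have "fprod V U \<le> G" by (simp add: le_residual_iff[symmetric])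
  then have "fprod V U = G"
    using assms V by (intro ultra_le_eq ultra_not_bot ultra_fprod)
  with V that show ?thesis by simp
qed

section \<open>Closed subsemigroups, minimal left ideals and idempotents\<close>

text \<open>
  A proper filter stands for the closed set of the ultrafilters below it; the closed sets that are
  subsemigroups under \<open>fprod\<close> correspond to the following filters.
\<close>

definition subsemi :: "'a filter \<Rightarrow> bool" where
  "subsemi S \<longleftrightarrow> S \<noteq> bot \<and> (\<forall>U V. ultra U \<longrightarrow> ultra V \<longrightarrow> U \<le> S \<longrightarrow> V \<le> S \<longrightarrow> fprod U V \<le> S)"

lemma subsemiI:
  "S \<noteq> bot \<Longrightarrow> (\<And>U V. ultra U \<Longrightarrow> ultra V \<Longrightarrow> U \<le> S \<Longrightarrow> V \<le> S \<Longrightarrow> fprod U V \<le> S) \<Longrightarrow> subsemi S"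
  by (simp add: subsemi_def)

lemma subsemi_not_bot: "subsemi S \<Longrightarrow> S \<noteq> bot"
  by (simp add: subsemi_def)

lemma subsemi_mult: "\<lbrakk>subsemi S; ultra U; ultra V; U \<le> S; V \<le> S\<rbrakk> \<Longrightarrow> fprod U V \<le> S"
  by (simp add: subsemi_def)

lemma subsemi_fprod:
  assumes "F \<noteq> bot" "ultra U" and "fprod F (fprod U F) \<le> F"
  shows "subsemi (fprod F U)"
proof (rule subsemiI)
  show "fprod F U \<noteq> bot" using assms by (simp add: fprod_not_bot ultra_not_bot)
next
  fix V V' assume V: "V \<le> fprod F U" "V' \<le> fprod F U"
  have "fprod V V' \<le> fprod (fprod F U) (fprod F U)" using V by (rule fprod_mono)
  also have "\<dots> = fprod (fprod F (fprod U F)) U" by (simp add: fprod_assoc)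
  also have "\<dots> \<le> fprod F U" by (rule fprod_mono[OF assms(3) order_refl])
  finally show "fprod V V' \<le> fprod F U" .
qed

text \<open>The argument of Ellis and Numakura. In a minimal closed subsemigroup \<open>M\<close>
  every \<open>U\<close> satisfies \<open>M U = M\<close>, so some \<open>V\<close> has
  \<open>V U = U\<close>; the \<open>V\<close> in \<open>M\<close> with this property form a closed
  subsemigroup again, hence all of \<open>M\<close>, and \<open>U\<close> itself is one of
  them.\<close>

lemma Ellis_idempotent:
  assumes "subsemi S"
  obtains U where "ultra U" "U \<le> S" "fprod U U = U"
proof -
  obtain M where M: "M \<le> S" "subsemi M" and min: "\<And>G. G \<le> M \<Longrightarrow> subsemi G \<Longrightarrow> G = M"
  proof (rule minimal_filter[of subsemi S, OF assms])
    fix C :: "'a filter set"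
    assume C: "C \<noteq> {}" "\<forall>A\<in>C. \<forall>B\<in>C. A \<le> B \<or> B \<le> A" "\<forall>A\<in>C. subsemi A"
    show "subsemi (Inf C)"
    proof (rule subsemiI)
      show "Inf C \<noteq> bot" using C by (intro Inf_chain_not_bot) (auto dest: subsemi_not_bot)
      fix U V assume "ultra U" "ultra V" "U \<le> Inf C" "V \<le> Inf C"
      then show "fprod U V \<le> Inf C" using C(3) by (auto simp: le_Inf_iff intro: subsemi_mult)
    qed
  qed blast
  obtain U where U: "ultra U" "U \<le> M" by (rule ultra_exists[OF subsemi_not_bot[OF M(2)]])
  have below: "\<exists>V. ultra V \<and> V \<le> M \<and> fprod V U = G" if "ultra G" "G \<le> fprod M U" for G
    using ultra_le_fprod[OF U(1) that] by metis
  \<comment> \<open>\<open>subsemi\<close> speaks of ultrafilters only, whereas \<open>M\<close> is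
    a filter. A set in \<open>M\<close> missing from \<open>fprod M U\<close> is therefore tested on
    an ultrafilter that contains its complement.\<close>
  have le: "fprod M U \<le> M"
  proof (rule ccontr)
    assume "\<not> fprod M U \<le> M"
    then obtain P where P: "eventually P M" "\<not> eventually P (fprod M U)" by (auto simp: le_filter_def)
    then have "inf (fprod M U) (principal {x. \<not> P x}) \<noteq> bot"
      by (simp add: trivial_limit_def eventually_inf_principal)
    then obtain G where G: "ultra G" "G \<le> inf (fprod M U) (principal {x. \<not> P x})" by (rule ultra_exists)
    then obtain V where V: "ultra V" "V \<le> M" "fprod V U = G" using below by auto
    then have "G \<le> M" using subsemi_mult[OF M(2) V(1) U(1) V(2) U(2)] by simp
    then have "eventually P G" using P by (auto simp: le_filter_def)
    moreover have "eventually (\<lambda>x. \<not> P x) G" using G by (simp add: le_principal)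
    ultimately show False using ultra_not[OF G(1)] by blast
  qed
  have "fprod M U = M"
  proof (rule min[OF le], rule subsemiI)
    show "fprod M U \<noteq> bot" using U M by (simp add: fprod_not_bot ultra_not_bot subsemi_not_bot)
    fix G G' assume G: "ultra G" "ultra G'" "G \<le> fprod M U" "G' \<le> fprod M U"
    then obtain V where V: "ultra V" "V \<le> M" "fprod V U = G'" using below by blast
    have "fprod G V \<le> M" using G(1) V(1) order_trans[OF G(3) le] V(2) by (rule subsemi_mult[OF M(2)])
    then have "fprod (fprod G V) U \<le> fprod M U" by (rule fprod_mono) simp
    then show "fprod G G' \<le> fprod M U" using V by (simp add: fprod_assoc)
  qed
  then obtain V where V: "ultra V" "V \<le> M" "fprod V U = U" using below[of U] U by auto
  have "inf M (residual U U) = M"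
  \<comment> \<open>The ultrafilters below \<open>residual U U\<close> are those \<open>A\<close>
    with \<open>A U = U\<close>; \<open>V\<close> shows that there is one below
    \<open>M\<close>.\<close>
  proof (rule min, simp, rule subsemiI)
    have "V \<le> inf M (residual U U)" using V by (simp add: le_residual_iff)
    then show "inf M (residual U U) \<noteq> bot" using V(1) ultra_not_bot by (metis bot.extremum_uniqueI)
    fix A B assume AB: "ultra A" "ultra B" "A \<le> inf M (residual U U)" "B \<le> inf M (residual U U)"
    have "fprod (fprod A B) U \<le> fprod A U"
      unfolding fprod_assoc using AB by (intro fprod_mono) (auto simp: le_residual_iff)
    also have "\<dots> \<le> U" using AB by (simp add: le_residual_iff)
    finally show "fprod A B \<le> inf M (residual U U)"
      using AB subsemi_mult[OF M(2)] by (simp add: le_residual_iff)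
  qed
  then have "fprod U U \<le> U" using U(2) by (metis le_inf_iff le_residual_iff)
  then have "fprod U U = U" using U by (intro ultra_le_eq) (auto simp: fprod_not_bot ultra_not_bot)
  with that[OF U(1) order_trans[OF U(2) M(1)]] show ?thesis by simp
qed

text \<open>
  The idempotent \<open>q\<close> lies in a minimal left ideal below \<open>C\<close>. If \<open>e\<close> is an idempotent in the left
  ideal of \<open>V\<close> generated by \<open>q\<close>, then \<open>r = q e\<close> satisfies \<open>q r = r q = r = r r\<close>, so the image of \<open>r\<close>
  under \<open>h\<close> is an idempotent below \<open>q\<close>, and hence \<open>q\<close> itself by minimality.
\<close>

lemma idempotent_with_preimage:
  assumes nb: "C \<noteq> bot" "V \<noteq> bot"
    and prods: "fprod C C \<le> C" "fprod V V \<le> V" "fprod C V \<le> V" "fprod V C \<le> V"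
    and hom: "\<And>h s t. h \<in> H \<Longrightarrow> h (f s t) = f (h s) (h t)"
    and HV: "\<And>h. h \<in> H \<Longrightarrow> filtermap h V \<le> C"
    and HC: "\<And>h. h \<in> H \<Longrightarrow> eventually (\<lambda>s. h s = s) C"
  obtains q r where "ultra q" "q \<le> C" "fprod q q = q" "ultra r" "r \<le> V"
    "\<And>h. h \<in> H \<Longrightarrow> filtermap h r = q"
proof -
  \<comment> \<open>The closed left ideals of the semigroup below \<open>C\<close>; an idempotent in
    a minimal one of them is a minimal idempotent.\<close>
  define left where "left L \<longleftrightarrow> L \<noteq> bot \<and> L \<le> C \<and> (\<forall>U. ultra U \<longrightarrow> U \<le> L \<longrightarrow> fprod C U \<le> L)" for L
  have "left C" unfolding left_def using nb prods(1)
    by (auto intro: order_trans[OF fprod_mono[OF order_refl]])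
  then obtain L where L: "left L" and min: "\<And>G. G \<le> L \<Longrightarrow> left G \<Longrightarrow> G = L"
  proof (rule minimal_filter[of left C])
    fix D assume D: "D \<noteq> {}" "\<forall>A\<in>D. \<forall>B\<in>D. A \<le> B \<or> B \<le> A" "\<forall>A\<in>D. left A"
    have "Inf D \<noteq> bot" using D by (intro Inf_chain_not_bot) (auto simp: left_def)
    moreover obtain A where "A \<in> D" using D(1) by auto
    then have "Inf D \<le> C" using D(3) by (intro order_trans[OF Inf_lower[of A D]]) (auto simp: left_def)
    ultimately show "left (Inf D)" using D(3) by (auto simp: left_def le_Inf_iff)
  qed blast
  \<comment> \<open>\<open>C U\<close> is a closed left ideal inside \<open>L\<close>, so each
    element of the minimal left ideal generates it.\<close>
  have LU: "fprod C U = L" if U: "ultra U" "U \<le> L" for U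
  proof (rule min)
    show le: "fprod C U \<le> L" using L U by (simp add: left_def)
    show "left (fprod C U)"
      unfolding left_def
    proof (intro conjI allI impI)
      show "fprod C U \<noteq> bot" using nb U by (simp add: fprod_not_bot ultra_not_bot)
      show "fprod C U \<le> C" using le L by (auto simp: left_def)
      fix W assume "W \<le> fprod C U"
      then have "fprod C W \<le> fprod (fprod C C) U" by (simp add: fprod_mono fprod_assoc)
      also have "\<dots> \<le> fprod C U" using prods(1) by (rule fprod_mono) simp
      finally show "fprod C W \<le> fprod C U" .
    qed
  qed
  have "subsemi L"
    using L unfolding left_def by (intro subsemiI) (auto intro: order_trans[OF fprod_mono[OF _ order_refl]])
  then obtain q where q: "ultra q" "q \<le> L" "fprod q q = q" by (rule Ellis_idempotent)
  have qC: "q \<le> C" using q L by (auto simp: left_def)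
  have "fprod V (fprod q V) \<le> V"
    using fprod_mono[OF order_refl order_trans[OF fprod_mono[OF qC order_refl] prods(3)], of V] prods(2)
    by (rule order_trans)
  then obtain e where e: "ultra e" "e \<le> fprod V q" "fprod e e = e"
    using Ellis_idempotent[OF subsemi_fprod[OF nb(2) q(1)]] by metis
  obtain y where "ultra y" "fprod y q = e" using ultra_le_fprod[OF q(1) e(1,2)] by blast
  then have eq: "fprod e q = e" using q(3) by (metis fprod_assoc)
  have eV: "e \<le> V" using order_trans[OF e(2) order_trans[OF fprod_mono[OF order_refl qC] prods(4)]] .
  define r where "r = fprod q e"
  have qr: "fprod q r = r" and rq: "fprod r q = r" and rr: "fprod r r = r"
    unfolding r_def using eq q(3) e(3) by (metis fprod_assoc)+
  have r: "ultra r" "r \<le> V"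
    unfolding r_def using ultra_fprod[OF q(1) e(1)] fprod_mono[OF qC eV] prods(3) by (auto intro: order_trans)
  have "filtermap h r = q" if h: "h \<in> H" for h
  proof -
    have "eventually (\<lambda>s. h s = s) q" using HC[OF h] qC by (simp add: le_filter_def)
    then have hq: "filtermap h q = q"
      unfolding filter_eq_iff eventually_filtermap by (auto elim: eventually_elim2)
    let ?p = "filtermap h r"
    note fm = filtermap_fprod[of h, OF hom[OF h]]
    have p: "ultra ?p" "?p \<le> C" "fprod q ?p = ?p" "fprod ?p q = ?p" "fprod ?p ?p = ?p"
      using ultra_filtermap[OF r(1)] order_trans[OF filtermap_mono[OF r(2)] HV[OF h]]
        fm[of q r] fm[of r q] fm[of r r] qr rq rr hq by auto
    \<comment> \<open>By \<open>?p = ?p q\<close> the image lies in \<open>C q\<close>, which is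
      \<open>L\<close>, and there it generates \<open>L\<close> just as \<open>q\<close> does. So
      \<open>q = z ?p\<close> for some \<open>z\<close>, and idempotence of \<open>?p\<close> gives
      \<open>q ?p = q\<close>.\<close>
    have "?p \<le> L" using fprod_mono[OF p(2) order_refl, of q] p(4) LU[OF q(1,2)] by simp
    then have "q \<le> fprod C ?p" using LU[OF p(1)] q(2) by simp
    then obtain z where "fprod z ?p = q" using ultra_le_fprod[OF p(1) q(1)] by metis
    then have "fprod q ?p = q" using p(5) by (metis fprod_assoc)
    with p(3) show ?thesis by simp
  qed
  with that q(1,3) qC r show ?thesis by blast
qed

text \<open>The refinement of \<open>A\<close> from Galvin's proof of Hindman's theorem: for an
  idempotent \<open>q\<close> it is large whenever \<open>A\<close> is, and unlike \<open>A\<close>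
  it absorbs almost every right factor of each of its elements.\<close>

definition star :: "'a filter \<Rightarrow> 'a set \<Rightarrow> 'a set" where
  "star q A = {s \<in> A. eventually (\<lambda>t. f s t \<in> A) q}"

lemma eventually_star:
  assumes "fprod q q = q" "eventually (\<lambda>s. s \<in> A) q"
  shows "eventually (\<lambda>s. s \<in> star q A) q"
proof -
  have "eventually (\<lambda>s. s \<in> A) (fprod q q)" using assms by simp
  then show ?thesis using assms(2) by (simp add: star_def eventually_fprod eventually_conj_iff)
qed

text \<open>If \<open>f s t\<close> is in \<open>A\<close> for almost all \<open>t\<close>, then, as
  \<open>q\<close> is idempotent, almost every such \<open>f s t\<close> itself stays in
  \<open>A\<close> under almost all further factors.\<close>

lemma star_shift:
  assumes "fprod q q = q" "s \<in> star q A"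
  shows "eventually (\<lambda>t. f s t \<in> star q A) q"
proof -
  have ev: "eventually (\<lambda>t. f s t \<in> A) q" using assms by (simp add: star_def)
  then have "eventually (\<lambda>t. f s t \<in> A) (fprod q q)" using assms by simp
  with ev show ?thesis by (simp add: star_def eventually_fprod eventually_conj_iff assoc)
qed

end

interpretation map_add: semigroup "(++)"
  by unfold_locales simp

subsection \<open>Words over an increasing sequence of finite alphabets\<close>

text \<open>
  A word is a partial function \<open>s\<close> on the positive integers, whose value is \<open>Some None\<close> at the places
  of the variable and \<open>Some (Some p)\<close> at the places of the letter \<open>p\<close>. It stands for the
  product of the words \<open>w n (p n)\<close> of a given sequence \<open>w\<close> over \<open>n \<in> dom s\<close>.
\<close>

definition wsub :: "'p \<Rightarrow> (nat \<rightharpoonup> 'p option) \<Rightarrow> (nat \<rightharpoonup> 'p option)" where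
  "wsub p s = (\<lambda>n. map_option (\<lambda>c. Some (case c of None \<Rightarrow> p | Some a \<Rightarrow> a)) (s n))"

lemma wsub_simps [simp]:
  "s n = None \<Longrightarrow> wsub p s n = None"
  "s n = Some None \<Longrightarrow> wsub p s n = Some (Some p)"
  "s n = Some (Some a) \<Longrightarrow> wsub p s n = Some (Some a)"
  by (simp_all add: wsub_def)

lemma dom_wsub [simp]: "dom (wsub p s) = dom s"
  by (auto simp: wsub_def dom_def)

lemma wsub_map_add: "wsub p (s ++ t) = wsub p s ++ wsub p t"
  by (auto simp: wsub_def map_add_def fun_eq_iff split: option.splits)

text \<open>\<open>P n\<close> becomes the range of the parameters at index \<open>n\<close>: pairs
  for two-sided words, single numbers for one-sided ones.\<close>

locale increasing_alphabets =
  fixes P :: "nat \<Rightarrow> 'p set"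
  assumes P_ne: "1 \<le> n \<Longrightarrow> P n \<noteq> {}"
    and P_finite: "1 \<le> n \<Longrightarrow> finite (P n)"
    and P_mono: "1 \<le> m \<Longrightarrow> m \<le> n \<Longrightarrow> P m \<subseteq> P n"
begin

text \<open>The bound \<open>n\<close> serves to push words to infinity; \<open>1 \<le> i\<close> is
  stated on its own so that \<open>n = 0\<close> imposes no further bound.\<close>

definition valid :: "nat \<Rightarrow> (nat \<rightharpoonup> 'p option) \<Rightarrow> bool" where
  "valid n s \<longleftrightarrow> finite (dom s) \<and> (\<forall>i z. s i = Some z \<longrightarrow> 1 \<le> i \<and> n \<le> i \<and> set_option z \<subseteq> P i)"

definition const_words :: "nat \<Rightarrow> (nat \<rightharpoonup> 'p option) set" where
  "const_words n = {s. valid n s \<and> s \<noteq> Map.empty \<and> (\<forall>i. s i \<noteq> Some None)}"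

definition var_words :: "nat \<Rightarrow> (nat \<rightharpoonup> 'p option) set" where
  "var_words n = {s. valid n s \<and> (\<exists>i. s i = Some None)}"

lemma valid_dom: "valid n s \<Longrightarrow> dom s \<subseteq> {max 1 n..}"
  by (auto simp: valid_def)

lemma valid_add: "valid n s \<Longrightarrow> valid n t \<Longrightarrow> valid n (s ++ t)"
  unfolding valid_def dom_map_add map_add_Some_iff by blast

lemma valid_anti: "m \<le> n \<Longrightarrow> valid n s \<Longrightarrow> valid m s"
  unfolding valid_def by (meson order_trans)

lemma const_words_anti: "m \<le> n \<Longrightarrow> const_words n \<subseteq> const_words m"
  unfolding const_words_def using valid_anti by blast

lemma var_words_anti: "m \<le> n \<Longrightarrow> var_words n \<subseteq> var_words m"
  unfolding var_words_def using valid_anti by blast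

lemma const_words_ne: "const_words n \<noteq> {}"
proof -
  obtain p where "p \<in> P (max 1 n)" using P_ne[of "max 1 n"] by auto
  then have "[max 1 n \<mapsto> Some p] \<in> const_words n" by (auto simp: const_words_def valid_def split: if_splits)
  then show ?thesis by blast
qed

lemma var_words_ne: "var_words n \<noteq> {}"
proof -
  have "[max 1 n \<mapsto> None] \<in> var_words n" by (auto simp: var_words_def valid_def split: if_splits)
  then show ?thesis by blast
qed

lemma beyond_dom:
  fixes s :: "nat \<rightharpoonup> 'p option"
  assumes "finite (dom s)"
  obtains m where "\<And>t :: nat \<rightharpoonup> 'p option. dom t \<subseteq> {max 1 m..} \<Longrightarrow> dom s \<inter> dom t = {} \<and> (\<forall>i\<in>dom s. \<forall>j\<in>dom t. i < j)"
proof (rule that)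
  fix t :: "nat \<rightharpoonup> 'p option"
  assume t: "dom t \<subseteq> {max 1 (Suc (Max (dom s)))..}"
  have "i < j" if "i \<in> dom s" "j \<in> dom t" for i j
    using Max_ge[OF assms that(1)] subsetD[OF t that(2)] by simp
  then show "dom s \<inter> dom t = {} \<and> (\<forall>i\<in>dom s. \<forall>j\<in>dom t. i < j)" by blast
qed

lemma const_words_add: "s \<in> const_words n \<Longrightarrow> t \<in> const_words n \<Longrightarrow> s ++ t \<in> const_words n"
proof -
  assume st: "s \<in> const_words n" "t \<in> const_words n"
  then have no_var: "(s ++ t) i \<noteq> Some None" for i by (auto simp: const_words_def map_add_Some_iff)
  from st(2) obtain i z where "t i = Some z" by (auto simp: const_words_def fun_eq_iff)
  then have "(s ++ t) i = Some z" by (rule map_add_find_right)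
  then have "s ++ t \<noteq> Map.empty" by auto
  moreover have "valid n (s ++ t)" by (rule valid_add) (use st in \<open>simp_all add: const_words_def\<close>)
  ultimately show "s ++ t \<in> const_words n" unfolding const_words_def using no_var by blast
qed

lemma var_words_add1: "s \<in> var_words n \<union> const_words n \<Longrightarrow> t \<in> var_words n \<Longrightarrow> s ++ t \<in> var_words n"
proof -
  assume st: "s \<in> var_words n \<union> const_words n" "t \<in> var_words n"
  then obtain i where "t i = Some None" by (auto simp: var_words_def)
  then have "(s ++ t) i = Some None" by (rule map_add_find_right)
  moreover have "valid n (s ++ t)" by (rule valid_add) (use st in \<open>auto simp: const_words_def var_words_def\<close>)
  ultimately show "s ++ t \<in> var_words n" unfolding var_words_def by (intro CollectI conjI exI)
qed

text \<open>A variable of the right factor always survives in \<open>++\<close>, but one of the left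
  factor only where the right factor does not override it; hence the disjointness.\<close>

lemma var_words_add2:
  assumes "s \<in> var_words n" "t \<in> const_words n" "dom s \<inter> dom t = {}"
  shows "s ++ t \<in> var_words n"
proof -
  obtain i where i: "s i = Some None" using assms(1) by (auto simp: var_words_def)
  with assms(3) have "t i = None" by (auto simp: dom_def)
  with i have "(s ++ t) i = Some None" by (simp add: map_add_def)
  moreover have "valid n (s ++ t)" by (rule valid_add) (use assms in \<open>auto simp: const_words_def var_words_def\<close>)
  ultimately show ?thesis unfolding var_words_def by (intro CollectI conjI exI)
qed

text \<open>A letter of \<open>P m\<close> is admissible at position \<open>i\<close> if
  \<open>m \<le> i\<close>, because the alphabets increase; so the whole domain has to lie from
  \<open>m\<close> on.\<close>

lemma valid_wsub:
  assumes "p \<in> P m" "1 \<le> m" "m \<le> n" "valid n s"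
  shows "valid n (wsub p s)"
proof -
  have "1 \<le> i \<and> n \<le> i \<and> set_option z \<subseteq> P i" if iz: "wsub p s i = Some z" for i z
  proof -
    obtain z' where z': "s i = Some z'" "z = Some (case z' of None \<Rightarrow> p | Some a \<Rightarrow> a)"
      using iz by (auto simp: wsub_def)
    then have "1 \<le> i" "n \<le> i" "set_option z' \<subseteq> P i" using assms(4) by (auto simp: valid_def)
    moreover have "p \<in> P i" using P_mono[of m i] assms calculation by auto
    ultimately show ?thesis using z'(2) by (cases z') auto
  qed
  with assms(4) show ?thesis by (simp add: valid_def)
qed

lemma wsub_var_words: "p \<in> P m \<Longrightarrow> 1 \<le> m \<Longrightarrow> m \<le> n \<Longrightarrow> s \<in> var_words n \<Longrightarrow> wsub p s \<in> const_words n"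
  using valid_wsub by (auto simp: var_words_def const_words_def wsub_def fun_eq_iff)

lemma wsub_const_words: "s \<in> const_words n \<Longrightarrow> wsub p s = s"
  unfolding const_words_def wsub_def
  by (auto simp: fun_eq_iff map_option_case split: option.splits)

section \<open>Words tending to infinity\<close>

definition const_filter :: "(nat \<rightharpoonup> 'p option) filter" where
  "const_filter = (INF n. principal (const_words n))"

definition var_filter :: "(nat \<rightharpoonup> 'p option) filter" where
  "var_filter = (INF n. principal (var_words n))"

lemma eventually_const_filter: "eventually Q const_filter \<longleftrightarrow> (\<exists>n. \<forall>s\<in>const_words n. Q s)"
  unfolding const_filter_def
proof (subst eventually_INF_base)
  show "\<exists>x\<in>UNIV. principal (const_words x) \<le> inf (principal (const_words a)) (principal (const_words b))" for a b
    using const_words_anti[of a "max a b"] const_words_anti[of b "max a b"] by (intro bexI[of _ "max a b"]) auto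
qed (auto simp: eventually_principal)

lemma eventually_var_filter: "eventually Q var_filter \<longleftrightarrow> (\<exists>n. \<forall>s\<in>var_words n. Q s)"
  unfolding var_filter_def
proof (subst eventually_INF_base)
  show "\<exists>x\<in>UNIV. principal (var_words x) \<le> inf (principal (var_words a)) (principal (var_words b))" for a b
    using var_words_anti[of a "max a b"] var_words_anti[of b "max a b"] by (intro bexI[of _ "max a b"]) auto
qed (auto simp: eventually_principal)

text \<open>Tails matter in two of the conditions: constant words far out do not override the
  variable of a fixed word \<open>s\<close>, and variable words far out admit a fixed letter at
  every position.\<close>

lemma idempotent_words:
  obtains q r where "ultra q" "q \<le> const_filter" "map_add.fprod q q = q" "ultra r" "r \<le> var_filter"
    "\<And>n p. 1 \<le> n \<Longrightarrow> p \<in> P n \<Longrightarrow> filtermap (wsub p) r = q"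
proof (rule map_add.idempotent_with_preimage[of const_filter var_filter "wsub ` (\<Union>n\<in>{1..}. P n)"])
  show "const_filter \<noteq> bot" "var_filter \<noteq> bot"
    using const_words_ne var_words_ne by (auto simp: trivial_limit_def eventually_const_filter eventually_var_filter)
  show "map_add.fprod const_filter const_filter \<le> const_filter" "map_add.fprod var_filter var_filter \<le> var_filter" "map_add.fprod const_filter var_filter \<le> var_filter"
    unfolding le_filter_def map_add.eventually_fprod eventually_const_filter eventually_var_filter
    using const_words_add var_words_add1 by blast+
  show "map_add.fprod var_filter const_filter \<le> var_filter"
    unfolding le_filter_def map_add.eventually_fprod eventually_const_filter eventually_var_filter
  proof (intro allI impI, elim exE, rule exI, rule ballI)
    fix Q n s assume Q: "\<forall>s\<in>var_words n. Q s" and s: "s \<in> var_words n"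
    then have "finite (dom s)" by (simp add: var_words_def valid_def)
    then obtain m where m: "\<And>t :: nat \<rightharpoonup> 'p option. dom t \<subseteq> {max 1 m..} \<Longrightarrow> dom s \<inter> dom t = {}"
      using beyond_dom by metis
    have "Q (s ++ t)" if t: "t \<in> const_words (max m n)" for t
    proof -
      have "t \<in> const_words n" "t \<in> const_words m" using t const_words_anti by (meson max.cobounded1 max.cobounded2 subsetD)+
      moreover have "dom s \<inter> dom t = {}" using m \<open>t \<in> const_words m\<close> valid_dom by (auto simp: const_words_def)
      ultimately show ?thesis using Q s var_words_add2 by blast
    qed
    then show "\<exists>m. \<forall>t\<in>const_words m. Q (s ++ t)" by blast
  qed
  fix h :: "(nat \<rightharpoonup> 'p option) \<Rightarrow> _" assume "h \<in> wsub ` (\<Union>n\<in>{1..}. P n)"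
  then obtain p m where p: "h = wsub p" "p \<in> P m" "1 \<le> m" by auto
  show "h (s ++ t) = h s ++ h t" for s t by (simp add: p wsub_map_add)
  show "\<forall>\<^sub>F s in const_filter. h s = s" unfolding eventually_const_filter p using wsub_const_words by blast
  show "filtermap h var_filter \<le> const_filter"
    unfolding le_filter_def eventually_filtermap eventually_const_filter eventually_var_filter
  proof (intro allI impI, elim exE, rule exI, rule ballI)
    fix Q n s assume Q: "\<forall>s\<in>const_words n. Q s" and s: "s \<in> var_words (max m n)"
    then have "wsub p s \<in> const_words n" using p wsub_var_words[of p m "max m n" s] const_words_anti[of n "max m n"] by auto
    then show "Q (h s)" using Q p by simp
  qed
qed (use that in blast)

section \<open>Sequences of variable words with controlled products\<close>

text \<open>
  The set \<open>B n\<close> contains all products of the words with indices \<open>n\<close> or more, as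
  \<open>B (n + 1)\<close> consists of words that stay in \<open>B n\<close> when multiplied by a value of the \<open>n\<close>-th word.
\<close>

lemma product_sequence:
  fixes A :: "nat \<Rightarrow> (nat \<rightharpoonup> 'p option) set"
  assumes q: "map_add.fprod q q = q" and r: "ultra r" "r \<le> var_filter"
    and rq: "\<And>n p. 1 \<le> n \<Longrightarrow> p \<in> P n \<Longrightarrow> filtermap (wsub p) r = q"
    and A: "\<And>n. eventually (\<lambda>s. s \<in> A n) q"
  obtains u where "\<And>n. 1 \<le> n \<Longrightarrow> u n \<in> var_words 0"
    "\<And>n. 1 \<le> n \<Longrightarrow> dom (u n) \<subseteq> {n..}"
    "\<And>n i j. 1 \<le> n \<Longrightarrow> i \<in> dom (u n) \<Longrightarrow> j \<in> dom (u (Suc n)) \<Longrightarrow> i < j"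
    "\<And>N ns c. \<lbrakk>1 \<le> N; ns \<noteq> []; sorted_wrt (<) ns; \<forall>n\<in>set ns. N \<le> n \<and> c n \<in> P n\<rbrakk>
       \<Longrightarrow> foldr (++) (map (\<lambda>n. wsub (c n) (u n)) ns) Map.empty \<in> A N"
proof -
  let ?star = "map_add.star q"
  \<comment> \<open>Dependent choice counts from 0, so the pair at stage \<open>k\<close> carries
    the word and the set of index \<open>Suc k\<close>.\<close>
  define inv where "inv k z \<longleftrightarrow> (case z of (u, B) \<Rightarrow>
      u \<in> var_words (Suc k) \<and> eventually (\<lambda>s. s \<in> B) q \<and> (\<forall>s\<in>B. eventually (\<lambda>t. s ++ t \<in> B) q) \<and>
      B \<subseteq> A (Suc k) \<and> (\<forall>p\<in>P (Suc k). wsub p u \<in> B))" for k z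
  define step where "step k z z' \<longleftrightarrow> (case z of (u, B) \<Rightarrow> case z' of (u', B') \<Rightarrow>
      B' \<subseteq> B \<and> (\<forall>p\<in>P (Suc k). \<forall>s\<in>B'. wsub p u ++ s \<in> B) \<and>
      (\<forall>i\<in>dom u. \<forall>j\<in>dom u'. i < j))" for k and z z' :: "(nat \<rightharpoonup> 'p option) \<times> (nat \<rightharpoonup> 'p option) set"
  \<comment> \<open>Since \<open>wsub p\<close> maps \<open>r\<close> to \<open>q\<close>, the value
    at \<open>p\<close> of \<open>r\<close>-almost every word lies in the \<open>q\<close>-large set
    \<open>B\<close>; only finitely many \<open>p\<close> have to be served at once.\<close>
  have choose: "\<exists>u. u \<in> var_words (max m n) \<and> (\<forall>p\<in>P n. wsub p u \<in> B)"
    if B: "eventually (\<lambda>s. s \<in> B) q" and n: "1 \<le> n" for B m n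
  proof -
    have "eventually (\<lambda>u. u \<in> var_words (max m n)) r"
      by (rule filter_leD[OF r(2)]) (auto simp: eventually_var_filter)
    moreover have "eventually (\<lambda>u. wsub p u \<in> B) r" if "p \<in> P n" for p
      using B unfolding rq[OF n that, symmetric] eventually_filtermap .
    then have "eventually (\<lambda>u. \<forall>p\<in>P n. wsub p u \<in> B) r"
      using P_finite[OF n] by (simp add: eventually_ball_finite)
    ultimately have "eventually (\<lambda>u. u \<in> var_words (max m n) \<and> (\<forall>p\<in>P n. wsub p u \<in> B)) r"
      by (rule eventually_conj)
    then show ?thesis using eventually_happens'[OF ultra_not_bot[OF r(1)]] by blast
  qed
  have base: "\<exists>z. inv 0 z"
  proof -
    let ?B = "?star (A 1)"
    have B: "eventually (\<lambda>s. s \<in> ?B) q" using map_add.eventually_star[OF q A] .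
    then obtain u where "u \<in> var_words (max 1 1)" "\<forall>p\<in>P 1. wsub p u \<in> ?B" using choose by blast
    then have "inv 0 (u, ?B)"
      using B map_add.star_shift[OF q] by (auto simp: inv_def) (auto simp: map_add.star_def)
    then show ?thesis by blast
  qed
  have next_step: "\<exists>z'. inv (Suc k) z' \<and> step k z z'" if "inv k z" for k z
  proof -
    obtain u B where z: "z = (u, B)" by (cases z)
    with that have u: "u \<in> var_words (Suc k)" and B: "eventually (\<lambda>s. s \<in> B) q"
      and shift: "\<And>s. s \<in> B \<Longrightarrow> eventually (\<lambda>t. s ++ t \<in> B) q"
      and uB: "\<And>p. p \<in> P (Suc k) \<Longrightarrow> wsub p u \<in> B"
      by (auto simp: inv_def)
    \<comment> \<open>The last condition allows any value of \<open>u\<close> to be put in front of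
      later products.\<close>
    define B' where "B' = {s \<in> B \<inter> ?star (A (Suc (Suc k))). \<forall>p\<in>P (Suc k). wsub p u ++ s \<in> B}"
    have fin: "finite (P (Suc k))" using P_finite by simp
    have "eventually (\<lambda>s. \<forall>p\<in>P (Suc k). wsub p u ++ s \<in> B) q"
      by (rule eventually_ball_finite[OF fin]) (use shift uB in blast)
    then have B': "eventually (\<lambda>s. s \<in> B') q"
      using B map_add.eventually_star[OF q A, of "Suc (Suc k)"] by (simp add: B'_def eventually_conj_iff)
    \<comment> \<open>By associativity \<open>t\<close> is a right factor of
      \<open>wsub p u ++ s\<close>, which lies in \<open>B\<close> since \<open>s\<close> is in
      \<open>B'\<close>; and \<open>B\<close> absorbs almost every right factor of its
      elements.\<close>
    have shift': "eventually (\<lambda>t. s ++ t \<in> B') q" if s: "s \<in> B'" for s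
    proof -
      have "eventually (\<lambda>t. \<forall>p\<in>P (Suc k). wsub p u ++ (s ++ t) \<in> B) q"
      proof (rule eventually_ball_finite[OF fin], rule ballI)
        fix p assume "p \<in> P (Suc k)"
        then have "wsub p u ++ s \<in> B" using s by (simp add: B'_def)
        then show "eventually (\<lambda>t. wsub p u ++ (s ++ t) \<in> B) q" using shift by simp
      qed
      then show ?thesis
        using s shift map_add.star_shift[OF q, of s "A (Suc (Suc k))"]
        by (simp add: B'_def eventually_conj_iff)
    qed
    have "finite (dom u)" using u by (simp add: var_words_def valid_def)
    then obtain m where m: "\<And>t :: nat \<rightharpoonup> 'p option. dom t \<subseteq> {max 1 m..} \<Longrightarrow> \<forall>i\<in>dom u. \<forall>j\<in>dom t. i < j"
      using beyond_dom by metis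
    obtain u' where u': "u' \<in> var_words (max m (Suc (Suc k)))" "\<forall>p\<in>P (Suc (Suc k)). wsub p u' \<in> B'"
      using choose[OF B', of "Suc (Suc k)"] by auto
    have "u' \<in> var_words m" "u' \<in> var_words (Suc (Suc k))"
      using u'(1) var_words_anti[of m "max m (Suc (Suc k))"] var_words_anti[of "Suc (Suc k)" "max m (Suc (Suc k))"]
      by auto
    moreover from this(1) have "dom u' \<subseteq> {max 1 m..}" using valid_dom by (simp add: var_words_def)
    ultimately have "inv (Suc k) (u', B')" "step k z (u', B')"
      using u'(2) B' shift' m[of u'] by (auto simp: inv_def step_def z B'_def map_add.star_def)
    then show ?thesis by blast
  qed
  obtain g where inv: "\<And>k. inv k (g k)" and step: "\<And>k. step k (g k) (g (Suc k))"
    using dependent_nat_choice[of inv step, OF base next_step] by metis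
  define u where "u n = fst (g (n - 1))" for n
  define B where "B n = snd (g (n - 1))" for n
  have uv: "u n \<in> var_words n" and BA: "B n \<subseteq> A n" and uB: "\<And>p. p \<in> P n \<Longrightarrow> wsub p (u n) \<in> B n" if "1 \<le> n" for n
    using inv[of "n - 1"] that by (auto simp: inv_def u_def B_def split: prod.splits)
  have BS: "B (Suc n) \<subseteq> B n" and mult: "\<And>p s. p \<in> P n \<Longrightarrow> s \<in> B (Suc n) \<Longrightarrow> wsub p (u n) ++ s \<in> B n"
    and dom_less: "\<And>i j. i \<in> dom (u n) \<Longrightarrow> j \<in> dom (u (Suc n)) \<Longrightarrow> i < j" if "1 \<le> n" for n
    using step[of "n - 1"] that by (auto simp: step_def u_def B_def split: prod.splits)
  have B_anti: "B n \<subseteq> B m" if "1 \<le> m" "m \<le> n" for m n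
    using that(2)
  proof (induction rule: dec_induct)
    case (step k)
    then show ?case using BS[of k] that(1) by auto
  qed simp
  \<comment> \<open>Induction from the left: the remaining factors have indices beyond
    \<open>n\<close>, so their product lies in \<open>B (Suc n)\<close> and may be preceded by a
    value of \<open>u n\<close>.\<close>
  have prod: "foldr (++) (map (\<lambda>n. wsub (c n) (u n)) ns) Map.empty \<in> B N"
    if "1 \<le> N" "ns \<noteq> []" "sorted_wrt (<) ns" "\<forall>n\<in>set ns. N \<le> n \<and> c n \<in> P n" for N ns c
    using that
  proof (induction ns arbitrary: N)
    case (Cons n ns)
    have n: "1 \<le> n" "N \<le> n" "c n \<in> P n" using Cons.prems by auto
    have "foldr (++) (map (\<lambda>n. wsub (c n) (u n)) (n # ns)) Map.empty \<in> B n"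
    proof (cases "ns = []")
      case True
      then show ?thesis using uB[OF n(1,3)] by simp
    next
      case False
      then have "foldr (++) (map (\<lambda>n. wsub (c n) (u n)) ns) Map.empty \<in> B (Suc n)"
        using Cons.prems by (intro Cons.IH) auto
      then show ?thesis using mult[OF n(1,3)] by simp
    qed
    then show ?case using B_anti Cons.prems(1) n(2) by blast
  qed simp
  show ?thesis
  proof (rule that[of u])
    fix n :: nat assume n: "1 \<le> n"
    show "u n \<in> var_words 0" using uv[OF n] var_words_anti[of 0 n] by auto
    show "dom (u n) \<subseteq> {n..}" using uv[OF n] valid_dom[of n "u n"] by (auto simp: var_words_def)
    fix i j assume "i \<in> dom (u n)" "j \<in> dom (u (Suc n))"
    then show "i < j" by (rule dom_less[OF n])
  next
    fix N ns c
    assume "1 \<le> N" "ns \<noteq> []" "sorted_wrt (<) ns" "\<forall>n\<in>set ns. N \<le> n \<and> c n \<in> P n"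
    then show "foldr (++) (map (\<lambda>n. wsub (c n) (u n)) ns) Map.empty \<in> A N" using prod BA by blast
  qed
qed

text \<open>The image of an ultrafilter in a compact set converges, so each ball around the limit
  \<open>x0\<close> gives a \<open>q\<close>-large set of words, to which the product construction
  applies.\<close>

lemma convergent_products:
  fixes F :: "(nat \<rightharpoonup> 'p option) \<Rightarrow> 'x::metric_space"
  assumes "compact X" and F: "\<And>s. s \<in> const_words 0 \<Longrightarrow> F s \<in> X"
  obtains u x0 where "x0 \<in> X" "\<And>n. 1 \<le> n \<Longrightarrow> u n \<in> var_words 0"
    "\<And>n. 1 \<le> n \<Longrightarrow> dom (u n) \<subseteq> {n..}"
    "\<And>n i j. 1 \<le> n \<Longrightarrow> i \<in> dom (u n) \<Longrightarrow> j \<in> dom (u (Suc n)) \<Longrightarrow> i < j"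
    "\<And>V. \<lbrakk>open V; x0 \<in> V\<rbrakk> \<Longrightarrow> \<exists>N\<ge>1. \<forall>ns c. ns \<noteq> [] \<and> sorted_wrt (<) ns \<and>
       (\<forall>n\<in>set ns. N \<le> n \<and> c n \<in> P n) \<longrightarrow>
       F (foldr (++) (map (\<lambda>n. wsub (c n) (u n)) ns) Map.empty) \<in> V"
proof -
  obtain q r where q: "ultra q" "q \<le> const_filter" "map_add.fprod q q = q" and r: "ultra r" "r \<le> var_filter"
    and rq: "\<And>n p. 1 \<le> n \<Longrightarrow> p \<in> P n \<Longrightarrow> filtermap (wsub p) r = q"
    by (rule idempotent_words) blast
  have Fq: "ultra (filtermap F q)" using q(1) by (rule ultra_filtermap)
  have "eventually (\<lambda>s. F s \<in> X) const_filter" unfolding eventually_const_filter using F by blast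
  then have "eventually (\<lambda>y. y \<in> X) (filtermap F q)"
    using q(2) by (simp add: eventually_filtermap le_filter_def)
  then obtain x0 where x0: "x0 \<in> X" "inf (nhds x0) (filtermap F q) \<noteq> bot"
    using assms(1) ultra_not_bot[OF Fq] unfolding compact_filter by blast
  \<comment> \<open>An ultrafilter converges to each of its cluster points.\<close>
  have "inf (nhds x0) (filtermap F q) = filtermap F q"
    by (rule ultra_le_eq[OF Fq _ x0(2)]) simp
  then have "filterlim F (nhds x0) q" unfolding filterlim_def by (metis inf.cobounded1)
  \<comment> \<open>\<open>1 / real 0\<close> is 0, and no distance is smaller; the premise makes
    \<open>A 0\<close> everything, so that every \<open>A n\<close> is
    \<open>q\<close>-large.\<close>
  define A where "A n = {s. 1 \<le> n \<longrightarrow> dist (F s) x0 < 1 / real n}" for n :: nat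
  have A: "eventually (\<lambda>s. s \<in> A n) q" for n
    using \<open>filterlim F (nhds x0) q\<close> by (cases "n = 0") (simp_all add: A_def tendsto_iff)
  obtain u where u: "\<And>n. 1 \<le> n \<Longrightarrow> u n \<in> var_words 0"
    "\<And>n. 1 \<le> n \<Longrightarrow> dom (u n) \<subseteq> {n..}"
    "\<And>n i j. 1 \<le> n \<Longrightarrow> i \<in> dom (u n) \<Longrightarrow> j \<in> dom (u (Suc n)) \<Longrightarrow> i < j"
    "\<And>N ns c. \<lbrakk>1 \<le> N; ns \<noteq> []; sorted_wrt (<) ns; \<forall>n\<in>set ns. N \<le> n \<and> c n \<in> P n\<rbrakk>
       \<Longrightarrow> foldr (++) (map (\<lambda>n. wsub (c n) (u n)) ns) Map.empty \<in> A N"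
    by (rule product_sequence[where A = A, OF q(3) r rq A]) blast+
  have lim: "\<exists>N\<ge>1. \<forall>ns c. ns \<noteq> [] \<and> sorted_wrt (<) ns \<and>
       (\<forall>n\<in>set ns. N \<le> n \<and> c n \<in> P n) \<longrightarrow>
       F (foldr (++) (map (\<lambda>n. wsub (c n) (u n)) ns) Map.empty) \<in> V" if V: "open V" "x0 \<in> V" for V
  proof -
    obtain e where e: "e > 0" "ball x0 e \<subseteq> V" using V openE by blast
    then obtain N where N: "1 / real (Suc N) < e" using nat_approx_posE by blast
    have "F (foldr (++) (map (\<lambda>n. wsub (c n) (u n)) ns) Map.empty) \<in> V"
      if "ns \<noteq> [] \<and> sorted_wrt (<) ns \<and> (\<forall>n\<in>set ns. Suc N \<le> n \<and> c n \<in> P n)" for ns c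
    proof -
      have "dist (F (foldr (++) (map (\<lambda>n. wsub (c n) (u n)) ns) Map.empty)) x0 < 1 / real (Suc N)"
        using u(4)[of "Suc N" ns c] that by (simp add: A_def)
      then show ?thesis using e(2) N by (auto simp: subset_iff dist_commute)
    qed
    then show ?thesis by (intro exI[of _ "Suc N"]) simp
  qed
  show ?thesis by (rule that[OF x0(1) u(1) u(2) u(3) lim])
qed

end

subsection \<open>Substitution in sequences of words\<close>

lemma stars_simps [simp]:
  "stars [] = Map.empty" "stars (v # vs) = v ++ stars vs" "stars (vs @ vs') = stars vs ++ stars vs'"
proof -
  show "stars (vs @ vs') = stars vs ++ stars vs'" by (induction vs) (simp_all add: stars_def)
qed (simp_all add: stars_def)

lemma dom_stars: "dom (stars vs) = (\<Union>v\<in>set vs. dom v)"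
  by (induction vs) auto

lemma stars_SomeD: "stars vs i = Some y \<Longrightarrow> \<exists>v\<in>set vs. v i = Some y"
  by (induction vs) (auto simp: map_add_Some_iff)

text \<open>Both relations \<open>R1_less\<close> and \<open>R2_less\<close> say this about the words of the respective kinds.\<close>

definition beyond :: "'a word_map \<Rightarrow> 'a word_map \<Rightarrow> bool" where
  "beyond v v' \<longleftrightarrow> (\<forall>j\<in>dom v. \<forall>i\<in>dom v'. (0 < i \<longrightarrow> j < i) \<and> (i < 0 \<longrightarrow> i < j))"

text \<open>
  The set \<open>sgs\<close> of the signs of the positions is \<open>{1, - 1}\<close> for two-sided and \<open>{1}\<close> for one-sided
  words, and \<open>L p i\<close> is the letter that the parameter \<open>p\<close> puts at position \<open>i\<close>.
\<close>

locale word_substitution = increasing_alphabets P for P :: "nat \<Rightarrow> 'p set" +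
  fixes \<alpha> :: "int \<Rightarrow> 'a" and k :: "int \<Rightarrow> nat" and \<upsilon> :: 'a and sgs :: "int set"
    and L :: "'p \<Rightarrow> int \<Rightarrow> 'a"
  assumes alphabet: "alphabet_setup \<alpha> k \<upsilon>"
    and sgs: "1 \<in> sgs"
    and L: "\<lbrakk>1 \<le> n; p \<in> P n; int n \<le> \<bar>i\<bar>; sgn i \<in> sgs\<rbrakk> \<Longrightarrow> L p i \<in> letters_at \<alpha> k i"
begin

definition sub :: "'a word_map \<Rightarrow> 'p option \<Rightarrow> 'a word_map" where
  "sub w c = (case c of None \<Rightarrow> w | Some p \<Rightarrow> (\<lambda>i. if w i = Some \<upsilon> then Some (L p i) else w i))"

definition sub_prod :: "(nat \<Rightarrow> 'a word_map) \<Rightarrow> (nat \<Rightarrow> 'p option) \<Rightarrow> nat list \<Rightarrow> 'a word_map" where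
  "sub_prod w c ns = stars (map (\<lambda>n. sub (w n) (c n)) ns)"

text \<open>The sign condition excludes two-sided words on one side of 0 only, for which
  \<open>R1_less\<close> does not reduce to \<open>beyond\<close>; products of values of the given
  words always satisfy it.\<close>

definition located_words :: "'a word_map set" where
  "located_words = {v \<in> words2 \<alpha> k. sgn ` dom v = sgs}"

definition located_vwords :: "'a word_map set" where
  "located_vwords = {v \<in> vwords \<alpha> k \<upsilon>. sgn ` dom v \<subseteq> sgs \<and> (\<forall>\<sigma>\<in>sgs. \<exists>i. sgn i = \<sigma> \<and> v i = Some \<upsilon>)}"

definition vseqs :: "(nat \<Rightarrow> 'a word_map) set" where
  "vseqs = {w. \<forall>n\<ge>1. w n \<in> located_vwords \<and> beyond (w n) (w (Suc n))}"

text \<open>Limits are first handled through the smallest index allowed in a product and only later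
  through its positions.\<close>

definition Ext_from :: "nat \<Rightarrow> (nat \<Rightarrow> 'a word_map) \<Rightarrow> 'a word_map set" where
  "Ext_from N w = {sub_prod w c ns | ns c.
     ns \<noteq> [] \<and> sorted_wrt (<) ns \<and> (\<forall>n\<in>set ns. N \<le> n \<and> c n \<in> Some ` P n)}"

definition ExtV :: "(nat \<Rightarrow> 'a word_map) \<Rightarrow> 'a word_map set" where
  "ExtV w = {sub_prod w c ns | ns c.
     ns \<noteq> [] \<and> sorted_wrt (<) ns \<and> (\<forall>n\<in>set ns. 1 \<le> n \<and> c n \<in> insert None (Some ` P n)) \<and>
     (\<exists>n\<in>set ns. c n = None)}"

lemma letters_at_ne_var: "i \<noteq> 0 \<Longrightarrow> y \<in> letters_at \<alpha> k i \<Longrightarrow> y \<noteq> \<upsilon>"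
  using alphabet by (auto simp: alphabet_setup_def letters_at_def split: if_splits)

lemma sub_None [simp]: "sub w None = w"
  by (simp add: sub_def)

lemma dom_sub [simp]: "dom (sub w c) = dom w"
  by (cases c) (auto simp: sub_def dom_def)

lemma sub_map_add: "sub (w ++ w') c = sub w c ++ sub w' c"
  by (cases c) (auto simp: sub_def map_add_def fun_eq_iff split: option.splits)

lemma sub_empty [simp]: "sub Map.empty c = Map.empty"
  by (cases c) (auto simp: sub_def)

lemma sgn_dom_vws: "v \<in> located_vwords \<Longrightarrow> sgn ` dom v = sgs"
  unfolding located_vwords_def by (auto simp: dom_def image_iff) metis

lemma finite_dom_vws: "v \<in> located_vwords \<Longrightarrow> finite (dom v)"
  by (simp add: located_vwords_def vwords_def)

lemma nonzero_vws: "v \<in> located_vwords \<Longrightarrow> i \<in> dom v \<Longrightarrow> i \<noteq> 0"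
  by (auto simp: located_vwords_def vwords_def)

lemma same_sgn:
  assumes "v \<in> located_vwords" "v' \<in> located_vwords" "i \<in> dom v"
  obtains i' where "i' \<in> dom v'" "sgn i' = sgn i"
proof -
  have "sgn i \<in> sgn ` dom v'" using assms sgn_dom_vws by blast
  then obtain i' where "sgn i = sgn i'" "i' \<in> dom v'" by (rule imageE)
  with that show ?thesis by simp
qed

text \<open>A position of \<open>c\<close> is compared with one of \<open>a\<close> through a
  position of \<open>b\<close> of the same sign, which exists because both \<open>b\<close> and
  \<open>c\<close> meet every sign in \<open>sgs\<close>.\<close>

lemma beyond_trans:
  assumes "beyond a b" "beyond b c" "b \<in> located_vwords" "c \<in> located_vwords"
  shows "beyond a c"
  unfolding beyond_def
proof (intro ballI)
  fix j i assume ji: "j \<in> dom a" "i \<in> dom c"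
  obtain i' where i': "i' \<in> dom b" "sgn i' = sgn i" using same_sgn[OF assms(4,3) ji(2)] by metis
  have "(0 < i' \<longrightarrow> j < i') \<and> (i' < 0 \<longrightarrow> i' < j)" "(0 < i \<longrightarrow> i' < i) \<and> (i < 0 \<longrightarrow> i < i')"
    using assms(1,2) ji i'(1) unfolding beyond_def by blast+
  with i'(2) show "(0 < i \<longrightarrow> j < i) \<and> (i < 0 \<longrightarrow> i < j)"
    by (auto simp: sgn_if split: if_splits)
qed

section \<open>Realizing index words as products\<close>

context
  fixes w :: "nat \<Rightarrow> 'a word_map"
  assumes w: "w \<in> vseqs"
begin

lemma vseqs_vws: "1 \<le> n \<Longrightarrow> w n \<in> located_vwords"
  using w by (simp add: vseqs_def)

lemma vseqs_beyond:
  assumes "1 \<le> m" "m < n"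
  shows "beyond (w m) (w n)"
proof -
  have "Suc m \<le> n" using assms by simp
  then show ?thesis
  proof (induction rule: dec_induct)
    case base
    then show ?case using w assms by (simp add: vseqs_def)
  next
    case (step n)
    have "beyond (w n) (w (Suc n))" using w step by (simp add: vseqs_def)
    with step show ?case using beyond_trans vseqs_vws by simp
  qed
qed

lemma vseqs_disjoint:
  assumes "1 \<le> m" "1 \<le> n" "i \<in> dom (w m)" "i \<in> dom (w n)"
  shows "m = n"
proof (rule ccontr)
  assume "m \<noteq> n"
  then have "beyond (w m) (w n) \<or> beyond (w n) (w m)"
    using vseqs_beyond assms(1,2) by (meson linorder_neqE_nat)
  moreover have "i \<noteq> 0" using nonzero_vws vseqs_vws assms by blast
  ultimately show False
    using assms(3,4) unfolding beyond_def by (metis linorder_neqE order_less_irrefl)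
qed

text \<open>Each word lies outside its predecessor on every side, so absolute values grow by at
  least one per index. This makes the parameters of index \<open>n\<close> admissible at all
  positions of \<open>w n\<close>.\<close>

lemma vseqs_large: "1 \<le> n \<Longrightarrow> i \<in> dom (w n) \<Longrightarrow> int n \<le> \<bar>i\<bar>"
proof (induction n arbitrary: i rule: dec_induct)
  case base
  then show ?case using nonzero_vws[OF vseqs_vws] by fastforce
next
  case (step n)
  have v: "w (Suc n) \<in> located_vwords" "w n \<in> located_vwords" using step vseqs_vws by simp_all
  obtain i' where i': "i' \<in> dom (w n)" "sgn i' = sgn i" using same_sgn[OF v step.prems] by metis
  have "beyond (w n) (w (Suc n))" using vseqs_beyond step.hyps by simp
  then have "(0 < i \<longrightarrow> i' < i) \<and> (i < 0 \<longrightarrow> i < i')"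
    using i'(1) step.prems unfolding beyond_def by blast
  moreover have "int n \<le> \<bar>i'\<bar>" using step.IH i'(1) by simp
  moreover have "i \<noteq> 0" using nonzero_vws v step.prems by blast
  ultimately show ?case using i'(2) by (auto simp: sgn_if split: if_splits)
qed

lemma L_vseqs: "\<lbrakk>1 \<le> n; p \<in> P n; i \<in> dom (w n)\<rbrakk> \<Longrightarrow> L p i \<in> letters_at \<alpha> k i"
  using L vseqs_large sgn_dom_vws vseqs_vws by blast

lemma sub_vseqs_letter:
  assumes "1 \<le> n" "set_option c \<subseteq> P n" "sub (w n) c i = Some y"
  shows "y \<in> letters_at \<alpha> k i \<or> c = None \<and> y = \<upsilon>"
proof -
  have "i \<in> dom (sub (w n) c)" using assms(3) by blast
  then have i: "i \<in> dom (w n)" by simp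
  then obtain z where z: "w n i = Some z" by blast
  have "z \<in> insert \<upsilon> (letters_at \<alpha> k i)"
    using vseqs_vws[OF assms(1)] z i by (force simp: located_vwords_def vwords_def)
  then show ?thesis
    using assms(2,3) z L_vseqs[OF assms(1) _ i] by (cases c) (auto simp: sub_def split: if_splits)
qed

definition realize :: "(nat \<rightharpoonup> 'p option) \<Rightarrow> 'a word_map" where
  "realize s = sub_prod w (\<lambda>n. the (s n)) (sorted_list_of_set (dom s))"

lemma sub_prod_realize:
  assumes "sorted_wrt (<) ns"
  shows "sub_prod w c ns = realize (\<lambda>n. if n \<in> set ns then Some (c n) else None)"
proof -
  have "dom (\<lambda>n. if n \<in> set ns then Some (c n) else None) = set ns" by (auto split: if_splits)
  moreover have "sorted_list_of_set (set ns) = ns"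
    using assms by (metis sorted_list_of_set.idem_if_sorted_distinct strict_sorted_iff)
  ultimately show ?thesis by (simp add: realize_def sub_prod_def cong: map_cong)
qed

lemma dom_realize: "finite (dom s) \<Longrightarrow> dom (realize s) = (\<Union>n\<in>dom s. dom (w n))"
  by (simp add: realize_def sub_prod_def dom_stars)

lemma realize_SomeD:
  assumes "finite (dom s)" "realize s i = Some y"
  obtains n c where "s n = Some c" "sub (w n) c i = Some y"
  using stars_SomeD[OF assms(2)[unfolded realize_def sub_prod_def]] assms(1) that by auto

lemma realize_empty [simp]: "realize Map.empty = Map.empty"
  by (simp add: realize_def sub_prod_def)

text \<open>With \<open>t\<close> beyond \<open>s\<close>, the increasing list of the joint domain
  is the concatenation of the two lists.\<close>

lemma realize_add:
  assumes "finite (dom s)" "finite (dom t)" "\<forall>i\<in>dom s. \<forall>j\<in>dom t. i < j"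
  shows "realize (s ++ t) = realize s ++ realize t"
proof -
  let ?l = sorted_list_of_set
  have fin: "finite (dom t \<union> dom s)" using assms by simp
  have "sorted_wrt (<) (?l (dom s) @ ?l (dom t))"
    using assms by (simp add: sorted_wrt_append)
  then have "?l (dom t \<union> dom s) = ?l (dom s) @ ?l (dom t)"
    using assms by (intro strict_sorted_equal) auto
  moreover have "map (\<lambda>n. sub (w n) (the ((s ++ t) n))) (?l (dom s)) = map (\<lambda>n. sub (w n) (the (s n))) (?l (dom s))"
  proof (rule map_cong[OF refl])
    fix n assume "n \<in> set (?l (dom s))"
    then have "n \<notin> dom t" using assms by auto
    then show "sub (w n) (the ((s ++ t) n)) = sub (w n) (the (s n))" by (simp add: map_add_dom_app_simps)
  qed
  moreover have "map (\<lambda>n. sub (w n) (the ((s ++ t) n))) (?l (dom t)) = map (\<lambda>n. sub (w n) (the (t n))) (?l (dom t))"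
    using assms by (intro map_cong) (auto simp: map_add_dom_app_simps)
  ultimately show ?thesis by (simp only: realize_def sub_prod_def dom_map_add map_append stars_simps)
qed

lemma beyond_realize:
  assumes "valid 0 s" "valid 0 t" "\<forall>i\<in>dom s. \<forall>j\<in>dom t. i < j"
  shows "beyond (realize s) (realize t)"
proof -
  have fin: "finite (dom s)" "finite (dom t)" using assms by (simp_all add: valid_def)
  have "beyond (w m) (w n)" if mn: "m \<in> dom s" "n \<in> dom t" for m n
    using assms mn valid_dom[of 0 s] by (intro vseqs_beyond) auto
  then show ?thesis unfolding beyond_def dom_realize[OF fin(1)] dom_realize[OF fin(2)] by blast
qed

text \<open>A letter once inserted differs from \<open>\<upsilon>\<close>, which is outside the
  alphabet, so a second substitution leaves it alone and only factors still carrying the variable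
  change.\<close>

lemma sub_realize:
  assumes "valid 0 s"
  shows "sub (realize s) (Some p) = realize (wsub p s)"
proof -
  have sub_sub: "sub (sub (w n) c) (Some p) = sub (w n) (Some (case c of None \<Rightarrow> p | Some a \<Rightarrow> a))"
    if c: "s n = Some c" for n c
  proof (cases c)
    case (Some a)
    then have n: "1 \<le> n" "a \<in> P n" using assms c by (auto simp: valid_def)
    have "sub (w n) (Some a) i \<noteq> Some \<upsilon>" for i
    proof
      assume i: "sub (w n) (Some a) i = Some \<upsilon>"
      then have "i \<in> dom (sub (w n) (Some a))" by blast
      then have "i \<noteq> 0" using nonzero_vws[OF vseqs_vws[OF n(1)]] by simp
      then show False using sub_vseqs_letter[OF n(1) _ i] n(2) letters_at_ne_var by auto
    qed
    then show ?thesis using Some by (simp add: sub_def[of "sub (w n) (Some a)"])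
  qed simp
  have "sub (stars (map (\<lambda>n. sub (w n) (the (s n))) ns)) (Some p) =
      stars (map (\<lambda>n. sub (w n) (the (wsub p s n))) ns)" if "set ns \<subseteq> dom s" for ns
    using that by (induction ns) (auto simp: sub_map_add sub_sub wsub_def)
  then show ?thesis using assms by (simp add: realize_def sub_prod_def valid_def)
qed

lemma realize_values:
  assumes "valid 0 s" "realize s i = Some y"
  shows "i \<noteq> 0" "sgn i \<in> sgs" "y \<in> letters_at \<alpha> k i \<or> (\<exists>n. s n = Some None) \<and> y = \<upsilon>"
proof -
  have "finite (dom s)" using assms by (simp add: valid_def)
  then obtain n c where n: "s n = Some c" "sub (w n) c i = Some y"
    using realize_SomeD assms(2) by metis
  have n1: "1 \<le> n" "set_option c \<subseteq> P n" using assms(1) n(1) by (simp_all add: valid_def)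
  have "i \<in> dom (sub (w n) c)" using n(2) by blast
  then have "i \<in> dom (w n)" by simp
  then show "i \<noteq> 0" "sgn i \<in> sgs" using nonzero_vws sgn_dom_vws vseqs_vws[OF n1(1)] by blast+
  show "y \<in> letters_at \<alpha> k i \<or> (\<exists>n. s n = Some None) \<and> y = \<upsilon>"
    using sub_vseqs_letter[OF n1 n(2)] n(1) by auto
qed

lemma realize_dom:
  assumes "valid 0 s" "s \<noteq> Map.empty"
  shows "finite (dom (realize s))" "sgn ` dom (realize s) = sgs"
proof -
  have fin: "finite (dom s)" and ge: "\<And>n. n \<in> dom s \<Longrightarrow> 1 \<le> n"
    using assms by (auto simp: valid_def)
  have v: "w n \<in> located_vwords" if "n \<in> dom s" for n using vseqs_vws ge that by blast
  then show "finite (dom (realize s))"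
    unfolding dom_realize[OF fin] using fin finite_dom_vws by blast
  have "sgn ` dom (realize s) = (\<Union>n\<in>dom s. sgn ` dom (w n))"
    unfolding dom_realize[OF fin] by blast
  also have "\<dots> = (\<Union>n\<in>dom s. sgs)" using v sgn_dom_vws by simp
  also have "\<dots> = sgs" using assms(2) by auto
  finally show "sgn ` dom (realize s) = sgs" .
qed

lemma realize_cwords:
  assumes "s \<in> const_words 0"
  shows "realize s \<in> located_words"
proof -
  have s: "valid 0 s" "s \<noteq> Map.empty" "\<And>n. s n \<noteq> Some None" using assms by (simp_all add: const_words_def)
  have "dom (realize s) \<noteq> {}" using realize_dom(2)[OF s(1,2)] sgs by blast
  moreover have "\<forall>i\<in>dom (realize s). i \<noteq> 0 \<and> the (realize s i) \<in> letters_at \<alpha> k i"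
    using realize_values[OF s(1)] s(3) by (metis domD option.sel)
  ultimately show ?thesis
    using realize_dom[OF s(1,2)] unfolding located_words_def words2_def by auto
qed

text \<open>A factor whose parameter is the variable is \<open>w n\<close> itself, and no other
  factor overrides its positions, the domains being disjoint; so \<open>\<upsilon>\<close> survives
  at every sign.\<close>

lemma realize_vws:
  assumes "s \<in> var_words 0"
  shows "realize s \<in> located_vwords"
proof -
  obtain n where s: "valid 0 s" and n: "s n = Some None" using assms by (auto simp: var_words_def)
  have ne: "s \<noteq> Map.empty" using n by auto
  have fin: "finite (dom s)" and n1: "1 \<le> n" using s n by (auto simp: valid_def)
  have var: "realize s i = Some \<upsilon>" if i: "w n i = Some \<upsilon>" for i
  proof -
    have "i \<in> dom (realize s)" unfolding dom_realize[OF fin] using n i by blast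
    then obtain y where y: "realize s i = Some y" by blast
    then obtain m c where m: "s m = Some c" "sub (w m) c i = Some y"
      using realize_SomeD fin by metis
    then have "i \<in> dom (sub (w m) c)" by blast
    then have "m = n" using vseqs_disjoint[of m n i] n1 m(1) s i by (auto simp: valid_def)
    with m n i y show ?thesis by simp
  qed
  have attained: "\<forall>\<sigma>\<in>sgs. \<exists>i. sgn i = \<sigma> \<and> realize s i = Some \<upsilon>"
    using vseqs_vws[OF n1] var unfolding located_vwords_def by blast
  then have "\<upsilon> \<in> ran (realize s)" using sgs by (auto simp: ran_def)
  moreover have "dom (realize s) \<noteq> {}" using realize_dom(2)[OF s ne] sgs by blast
  moreover have "\<forall>i\<in>dom (realize s). i \<noteq> 0 \<and> the (realize s i) \<in> insert \<upsilon> (letters_at \<alpha> k i)"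
    using realize_values[OF s] by (metis domD insertCI option.sel)
  ultimately show ?thesis
    using realize_dom[OF s ne] attained unfolding located_vwords_def vwords_def by auto
qed

lemma realize_ExtV:
  assumes "s \<in> var_words 0"
  shows "realize s \<in> ExtV w"
proof -
  obtain n where s: "valid 0 s" and n: "s n = Some None" using assms by (auto simp: var_words_def)
  then have fin: "finite (dom s)" by (simp add: valid_def)
  have "1 \<le> m \<and> the (s m) \<in> insert None (Some ` P m)" if "m \<in> dom s" for m
    using s that unfolding valid_def by (cases "the (s m)") force+
  then show ?thesis
    unfolding ExtV_def realize_def using fin n
    by (intro CollectI exI[of _ "sorted_list_of_set (dom s)"] exI[of _ "\<lambda>n. the (s n)"]) force
qed

text \<open>Extracting from an extraction is extracting from the original sequence: this carries the
  control over products of index words to the products formed from the new sequence.\<close>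

lemma realize_fold:
  assumes "\<And>n. 1 \<le> n \<Longrightarrow> u n \<in> var_words 0"
    and "\<And>m n i j. \<lbrakk>1 \<le> m; m < n; i \<in> dom (u m); j \<in> dom (u n)\<rbrakk> \<Longrightarrow> i < j"
    and "sorted_wrt (<) ns" "\<forall>n\<in>set ns. 1 \<le> n"
  shows "realize (foldr (++) (map (\<lambda>n. wsub (c n) (u n)) ns) Map.empty) =
    sub_prod (\<lambda>n. realize (u n)) (\<lambda>n. Some (c n)) ns"
  using assms(3,4)
proof (induction ns)
  case Nil
  then show ?case by (simp add: sub_prod_def)
next
  case (Cons n ns)
  let ?t = "\<lambda>ns. foldr (++) (map (\<lambda>n. wsub (c n) (u n)) ns) Map.empty"
  have dom_t: "dom (?t ms) = (\<Union>m\<in>set ms. dom (u m))" for ms by (induction ms) auto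
  have fin: "finite (dom (u m))" if "1 \<le> m" for m using assms(1)[OF that] by (simp add: var_words_def valid_def)
  have n: "1 \<le> n" using Cons.prems by simp
  have less: "\<forall>i\<in>dom (wsub (c n) (u n)). \<forall>j\<in>dom (?t ns). i < j"
  proof (intro ballI)
    fix i j assume i: "i \<in> dom (wsub (c n) (u n))" and "j \<in> dom (?t ns)"
    then obtain m where m: "m \<in> set ns" "j \<in> dom (u m)" unfolding dom_t by blast
    with Cons.prems have "n < m" by simp
    then show "i < j" using assms(2)[OF n] i m(2) by simp
  qed
  have "realize (?t (n # ns)) = realize (wsub (c n) (u n) ++ ?t ns)" by simp
  also have "\<dots> = realize (wsub (c n) (u n)) ++ realize (?t ns)"
    using Cons.prems fin n less by (intro realize_add) (simp_all add: dom_t)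
  also have "realize (wsub (c n) (u n)) = sub (realize (u n)) (Some (c n))"
    using assms(1)[OF n] by (simp add: sub_realize var_words_def)
  also have "realize (?t ns) = sub_prod (\<lambda>n. realize (u n)) (\<lambda>n. Some (c n)) ns"
    using Cons by simp
  finally show ?case by (simp add: sub_prod_def)
qed

text \<open>Each of the finitely many words of index below \<open>N\<close> has a positive position,
  necessarily below \<open>n0\<close>; a product whose positive positions are all at least
  \<open>n0\<close> therefore uses none of them.\<close>

lemma Ext_from_far:
  "\<exists>n0\<ge>1::nat. \<forall>v\<in>Ext_from 1 w. (\<forall>i\<in>dom v. 0 < i \<longrightarrow> int n0 \<le> i) \<longrightarrow> v \<in> Ext_from N w"
proof -
  define S where "S = (\<Union>n\<in>{1..<N}. dom (w n))"
  have S: "finite S" unfolding S_def using finite_dom_vws vseqs_vws by auto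
  \<comment> \<open>Inserting 1 keeps the maximum defined when \<open>S\<close> is empty.\<close>
  define n0 where "n0 = Suc (nat (Max (insert 1 S)))"
  have "i < int n0" if "i \<in> S" for i
  proof -
    have "i \<le> Max (insert 1 S)" by (rule Max_ge) (use S that in auto)
    then show ?thesis unfolding n0_def by linarith
  qed
  moreover have "v \<in> Ext_from N w"
    if v: "v \<in> Ext_from 1 w" and far: "\<forall>i\<in>dom v. 0 < i \<longrightarrow> int n0 \<le> i" and n0: "\<And>i. i \<in> S \<Longrightarrow> i < int n0" for v
  proof -
    obtain ns c where ns: "v = sub_prod w c ns" "ns \<noteq> []" "sorted_wrt (<) ns"
      "\<forall>n\<in>set ns. 1 \<le> n \<and> c n \<in> Some ` P n"
      using v unfolding Ext_from_def by blast
    have "N \<le> n" if n: "n \<in> set ns" for n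
    proof (rule ccontr)
      assume "\<not> N \<le> n"
      then have "n \<in> {1..<N}" using n ns(4) by auto
      then have sub: "dom (w n) \<subseteq> S" unfolding S_def by blast
      have "1 \<in> sgn ` dom (w n)" using sgs sgn_dom_vws vseqs_vws n ns(4) by blast
      then obtain i where i: "i \<in> dom (w n)" "0 < i" by (auto simp: sgn_if split: if_splits)
      have "i \<in> dom v" using i n ns(1) by (auto simp: sub_prod_def dom_stars)
      then have "int n0 \<le> i" using far i(2) by blast
      moreover have "i < int n0" using n0 sub i(1) by blast
      ultimately show False by simp
    qed
    then show ?thesis using ns unfolding Ext_from_def by blast
  qed
  ultimately show ?thesis by (intro exI[of _ n0]) (auto simp: n0_def)
qed

end

section \<open>Recurrence of the limit point\<close>

lemma fixed_point:
  fixes X :: "'x::metric_space set"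
  assumes T: "\<And>v. v \<in> located_words \<Longrightarrow> continuous_on X (T v) \<and> T v ` X \<subseteq> X"
    and TT: "\<And>v v' y. \<lbrakk>v \<in> located_words; v' \<in> located_words; beyond v v'; y \<in> X\<rbrakk> \<Longrightarrow> T v (T v' y) = T (v ++ v') y"
    and x: "x \<in> X" "x0 \<in> X" and u: "u \<in> vseqs"
    and lim: "\<And>V. \<lbrakk>open V; x0 \<in> V\<rbrakk> \<Longrightarrow> \<exists>N\<ge>1. \<forall>v\<in>Ext_from N u. T v x \<in> V"
    and V: "open V" "x0 \<in> V"
  shows "\<exists>N\<ge>1. \<forall>v\<in>Ext_from N u. T v x0 \<in> V"
proof -
  obtain e where e: "e > 0" "ball x0 e \<subseteq> V" using V openE by blast
  \<comment> \<open>The radius is halved because the strict bound weakens to \<open>\<le>\<close> in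
    the limit.\<close>
  obtain N where N: "N \<ge> 1" "\<And>v. v \<in> Ext_from N u \<Longrightarrow> dist (T v x) x0 < e / 2"
    using lim[of "ball x0 (e / 2)"] e(1) by (auto simp: dist_commute)
  define p where "p n = (SOME p. p \<in> P n)" for n
  have p: "p n \<in> P n" if "1 \<le> n" for n
    using P_ne[OF that] unfolding p_def by (simp add: some_in_eq)
  \<comment> \<open>One-factor products of growing index are the simplest words moving to infinity;
    any admissible parameter will do.\<close>
  define single where "single m = sub (u m) (Some (p m))" for m
  have single: "single m \<in> Ext_from M u" if "1 \<le> m" "M \<le> m" for m M
    unfolding Ext_from_def using that p
    by (intro CollectI exI[of _ "[m]"] exI[of _ "\<lambda>n. Some (p n)"]) (simp add: single_def sub_prod_def)
  have const_words: "(\<lambda>n. if n \<in> set ns then Some (c n) else None) \<in> const_words 0"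
    if "ns \<noteq> []" "\<forall>n\<in>set ns. 1 \<le> n \<and> c n \<in> Some ` P n" for ns c
  proof -
    let ?s = "\<lambda>n. if n \<in> set ns then Some (c n) else None"
    have dom: "dom ?s = set ns" by (auto split: if_splits)
    have "valid 0 ?s" unfolding valid_def dom using that(2) by (force split: if_splits)
    moreover have "?s \<noteq> Map.empty" using dom that(1) by (metis dom_empty set_empty)
    moreover have "?s n \<noteq> Some None" for n using that(2) by auto
    ultimately show ?thesis unfolding const_words_def by blast
  qed
  have "T v x0 \<in> V" if v: "v \<in> Ext_from N u" for v
  proof -
    obtain ns c where ns: "v = sub_prod u c ns" "ns \<noteq> []" "sorted_wrt (<) ns"
      "\<forall>n\<in>set ns. N \<le> n \<and> c n \<in> Some ` P n"
      using v unfolding Ext_from_def by blast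
    let ?s = "\<lambda>n. if n \<in> set ns then Some (c n) else None"
    have s: "?s \<in> const_words 0" using ns N(1) by (intro const_words) auto
    have v_eq: "v = realize u ?s" using sub_prod_realize[OF u ns(3)] ns(1) by simp
    then have vc: "v \<in> located_words" using realize_cwords[OF u s] by simp
    define M where "M = Suc (Max (set ns))"
    have M: "n < m" if "M \<le> m" "n \<in> set ns" for m n
    proof -
      have "n \<le> Max (set ns)" by (rule Max_ge) (use that in auto)
      then show ?thesis using that(1) unfolding M_def by linarith
    qed
    have far: "single m \<in> located_words \<and> dist (T v (T (single m) x)) x0 < e / 2" if m: "M \<le> m" for m
    proof -
      have "hd ns \<in> set ns" using ns(2) by simp
      then have "N \<le> hd ns" "hd ns < m" using ns(4) M[OF m] by blast+
      then have Nm: "N \<le> m" by simp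
      then have m1: "1 \<le> m" using N(1) by simp
      let ?t = "\<lambda>n. if n \<in> set [m] then Some (Some (p n)) else None"
      have t: "?t \<in> const_words 0" using const_words[of "[m]" "\<lambda>n. Some (p n)"] p m1 by simp
      have "sorted_wrt (<) [m]" by simp
      from sub_prod_realize[OF u this, of "\<lambda>n. Some (p n)"] have t_eq: "single m = realize u ?t"
        by (simp only: single_def sub_prod_def list.map stars_simps map_add_empty)
      then have tc: "single m \<in> located_words" using realize_cwords[OF u t] by simp
      have "beyond v (single m)"
        unfolding v_eq t_eq using s t M[OF m]
        by (intro beyond_realize[OF u]) (auto simp: const_words_def split: if_splits)
      then have "T v (T (single m) x) = T (v ++ single m) x" using TT vc tc x by blast
      moreover have "v ++ single m \<in> Ext_from N u"
        unfolding Ext_from_def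
      proof (intro CollectI exI conjI)
        \<comment> \<open>\<open>m\<close> exceeds all entries of \<open>ns\<close>, so appending it
          keeps the list increasing and its parameter can be set freely.\<close>
        let ?c = "\<lambda>n. if n \<in> set ns then c n else Some (p n)"
        have "m \<notin> set ns" using M[OF m] by blast
        then show "v ++ single m = sub_prod u ?c (ns @ [m])"
          by (simp add: ns(1) sub_prod_def single_def cong: map_cong)
        show "sorted_wrt (<) (ns @ [m])" using ns(3) M[OF m] by (simp add: sorted_wrt_append)
        show "\<forall>n\<in>set (ns @ [m]). N \<le> n \<and> ?c n \<in> Some ` P n" using ns(4) Nm p m1 by auto
      qed simp
      ultimately show ?thesis using N(2) tc by simp
    qed
    \<comment> \<open>\<open>T v\<close> is continuous on \<open>X\<close> only, so the points have
      to stay in \<open>X\<close> for the limit to pass through \<open>T v\<close>.\<close>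
    have inX: "\<forall>\<^sub>F m in sequentially. T (single m) x \<in> X"
      using far T x(1) by (intro eventually_sequentiallyI[of M]) blast
    have "(\<lambda>m. T (single m) x) \<longlonglongrightarrow> x0"
      unfolding tendsto_def
    proof (intro allI impI)
      fix W assume "open W" "x0 \<in> W"
      then obtain K where "K \<ge> 1" "\<forall>v\<in>Ext_from K u. T v x \<in> W" using lim by blast
      then show "\<forall>\<^sub>F m in sequentially. T (single m) x \<in> W"
        using single by (intro eventually_sequentiallyI[of K]) auto
    qed
    then have "(\<lambda>m. T v (T (single m) x)) \<longlonglongrightarrow> T v x0"
      using T[OF vc] x(2) inX by (intro continuous_on_tendsto_compose[of X "T v"]) auto
    then have "(\<lambda>m. dist (T v (T (single m) x)) x0) \<longlonglongrightarrow> dist (T v x0) x0"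
      by (intro tendsto_intros)
    moreover have "\<forall>\<^sub>F m in sequentially. dist (T v (T (single m) x)) x0 \<le> e / 2"
      using far by (intro eventually_sequentiallyI[of M]) (auto intro: less_imp_le)
    ultimately have "dist (T v x0) x0 \<le> e / 2" by (rule tendsto_upperbound) simp
    then show ?thesis using e by (auto simp: subset_iff dist_commute)
  qed
  with N(1) show ?thesis by blast
qed

text \<open>The common form of both cases. The products are controlled for the function
  \<open>s \<mapsto> T (realize w s) x\<close>, and the index words obtained are realized in
  \<open>w\<close> to give the extraction.\<close>

lemma recurrent_extraction:
  fixes X :: "'x::metric_space set"
  assumes "compact X" and x: "x \<in> X" and w: "w \<in> vseqs"
    and T: "\<And>v. v \<in> located_words \<Longrightarrow> continuous_on X (T v) \<and> T v ` X \<subseteq> X"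
    and TT: "\<And>v v' y. \<lbrakk>v \<in> located_words; v' \<in> located_words; beyond v v'; y \<in> X\<rbrakk> \<Longrightarrow> T v (T v' y) = T (v ++ v') y"
  obtains u x0 where "u \<in> vseqs" "\<And>n. 1 \<le> n \<Longrightarrow> u n \<in> ExtV w" "x0 \<in> X"
    "\<And>y V. \<lbrakk>y = x \<or> y = x0; open V; x0 \<in> V\<rbrakk> \<Longrightarrow> \<exists>n0\<ge>1::nat. \<forall>v\<in>Ext_from 1 u.
       (\<forall>i\<in>dom v. 0 < i \<longrightarrow> int n0 \<le> i) \<longrightarrow> T v y \<in> V"
proof -
  let ?F = "\<lambda>s. T (realize w s) x"
  have F: "?F s \<in> X" if "s \<in> const_words 0" for s using realize_cwords[OF w that] T x by blast
  obtain g x0 where x0: "x0 \<in> X" and g: "\<And>n. 1 \<le> n \<Longrightarrow> g n \<in> var_words 0"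
    and g_less: "\<And>n i j. 1 \<le> n \<Longrightarrow> i \<in> dom (g n) \<Longrightarrow> j \<in> dom (g (Suc n)) \<Longrightarrow> i < j"
    and g_lim: "\<And>V. \<lbrakk>open V; x0 \<in> V\<rbrakk> \<Longrightarrow> \<exists>N\<ge>1. \<forall>ns c. ns \<noteq> [] \<and> sorted_wrt (<) ns \<and>
       (\<forall>n\<in>set ns. N \<le> n \<and> c n \<in> P n) \<longrightarrow>
       ?F (foldr (++) (map (\<lambda>n. wsub (c n) (g n)) ns) Map.empty) \<in> V"
    by (rule convergent_products[where F = ?F, OF assms(1) F]) blast+
  \<comment> \<open>Only consecutive domains are known to be ordered; the position of a variable in
    the intermediate word links them.\<close>
  have dom_less: "i < j" if "1 \<le> m" "m < n" "i \<in> dom (g m)" "j \<in> dom (g n)" for m n i j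
  proof -
    have "Suc m \<le> n" using that by simp
    then show ?thesis using that(4)
    proof (induction arbitrary: j rule: dec_induct)
      case base
      then show ?case using g_less that by blast
    next
      case (step n)
      obtain i' where "g n i' = Some None" using g[of n] step.hyps by (auto simp: var_words_def)
      then have "i' \<in> dom (g n)" by blast
      then have "i < i'" "i' < j" using step g_less[of n i' j] by auto
      then show ?case by simp
    qed
  qed
  define u where "u n = realize w (g n)" for n
  then have u_eq: "u = (\<lambda>n. realize w (g n))" by (simp add: fun_eq_iff)
  have u: "u \<in> vseqs"
    unfolding vseqs_def u_def
  proof (intro CollectI allI impI conjI)
    fix n :: nat assume n: "1 \<le> n"
    show "realize w (g n) \<in> located_vwords" using realize_vws[OF w g[OF n]] .
    show "beyond (realize w (g n)) (realize w (g (Suc n)))"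
      using g[of n] g[of "Suc n"] n g_less[OF n] by (intro beyond_realize[OF w]) (auto simp: var_words_def)
  qed
  have lim: "\<exists>N\<ge>1. \<forall>v\<in>Ext_from N u. T v x \<in> V" if V: "open V" "x0 \<in> V" for V
  proof -
    obtain N where N: "N \<ge> 1" "\<And>ns c. \<lbrakk>ns \<noteq> []; sorted_wrt (<) ns; \<forall>n\<in>set ns. N \<le> n \<and> c n \<in> P n\<rbrakk> \<Longrightarrow>
       ?F (foldr (++) (map (\<lambda>n. wsub (c n) (g n)) ns) Map.empty) \<in> V"
      using g_lim[OF V] by blast
    have "T v x \<in> V" if v: "v \<in> Ext_from N u" for v
    proof -
      obtain ns c where ns: "v = sub_prod u c ns" "ns \<noteq> []" "sorted_wrt (<) ns"
        "\<forall>n\<in>set ns. N \<le> n \<and> c n \<in> Some ` P n"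
        using v unfolding Ext_from_def by blast
      let ?c = "\<lambda>n. the (c n)"
      have "v = sub_prod u (\<lambda>n. Some (?c n)) ns"
        unfolding ns(1) sub_prod_def using ns(4) by (intro arg_cong[of _ _ stars] map_cong) auto
      also have "\<dots> = realize w (foldr (++) (map (\<lambda>n. wsub (?c n) (g n)) ns) Map.empty)"
      proof -
        have "\<forall>n\<in>set ns. 1 \<le> n" using ns(4) N(1) order_trans by blast
        from realize_fold[OF w g dom_less ns(3) this, where c = ?c] show ?thesis
          unfolding u_eq by (rule sym)
      qed
      finally show ?thesis using N(2)[of ns ?c] ns(2-4) by force
    qed
    with N(1) show ?thesis by blast
  qed
  have lim0: "\<exists>N\<ge>1. \<forall>v\<in>Ext_from N u. T v y \<in> V" if "y = x \<or> y = x0" "open V" "x0 \<in> V" for y V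
    using lim fixed_point[OF T TT x x0 u lim] that by blast
  show ?thesis
  proof (rule that[OF u _ x0])
    fix n :: nat assume "1 \<le> n"
    then show "u n \<in> ExtV w" unfolding u_def using realize_ExtV[OF w g] by blast
  next
    fix y V assume "y = x \<or> y = x0" "open V" "x0 \<in> V"
    then obtain N where "\<forall>v\<in>Ext_from N u. T v y \<in> V" using lim0 by blast
    then show "\<exists>n0\<ge>1::nat. \<forall>v\<in>Ext_from 1 u. (\<forall>i\<in>dom v. 0 < i \<longrightarrow> int n0 \<le> i) \<longrightarrow> T v y \<in> V"
      using Ext_from_far[OF u, of N] by blast
  qed
qed

end

lemma (in word_substitution) finite_dom_Ext_from:
  assumes "u \<in> vseqs" "v \<in> Ext_from 1 u"
  shows "finite (dom v)"
  using assms finite_dom_vws[OF vseqs_vws[OF assms(1)]]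
  by (auto simp: Ext_from_def sub_prod_def dom_stars)

subsection \<open>The two-sided and the one-sided case\<close>

text \<open>\<open>A1\<close> and \<open>A2\<close> are arbitrary in \<open>R1_less\<close>, but
  \<open>v\<close> has positions on both sides of 0: whatever lies below all of \<open>v\<close> is
  negative and whatever lies above is positive. So they can only be the negative and the positive
  part of \<open>dom v'\<close>.\<close>

lemma R1_less_iff_beyond:
  assumes "finite (dom v)" "finite (dom v')" "0 \<notin> dom v'"
    and "sgn ` dom v = {1, - 1}" "sgn ` dom v' = {1, - 1}"
  shows "R1_less v v' \<longleftrightarrow> beyond v v'"
proof -
  have signs: "\<exists>i\<in>dom u. 0 < i" "\<exists>i\<in>dom u. i < 0" if "sgn ` dom u = {1, - 1}" for u :: "'a word_map"
  proof -
    have "1 \<in> sgn ` dom u" "- 1 \<in> sgn ` dom u" using that by auto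
    then show "\<exists>i\<in>dom u. 0 < i" "\<exists>i\<in>dom u. i < 0" by (force simp: sgn_if split: if_splits)+
  qed
  obtain a b where ab: "a \<in> dom v" "0 < a" "b \<in> dom v" "b < 0" using signs[OF assms(4)] by blast
  show ?thesis
  proof
    assume "R1_less v v'"
    then obtain A1 A2 where A: "dom v' = A1 \<union> A2" "Max A1 < Min (dom v)" "Max (dom v) < Min A2"
      unfolding R1_less_def by blast
    have fin: "finite A1" "finite A2" using A(1) assms(2) by (metis finite_Un)+
    have A1: "i < j" if "i \<in> A1" "j \<in> dom v" for i j
      using Max_ge[OF fin(1) that(1)] Min_le[OF assms(1) that(2)] A(2) by linarith
    have A2: "j < i" if "i \<in> A2" "j \<in> dom v" for i j
      using Min_le[OF fin(2) that(1)] Max_ge[OF assms(1) that(2)] A(3) by linarith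
    show "beyond v v'"
      unfolding beyond_def
    proof (intro ballI)
      fix j i assume "j \<in> dom v" "i \<in> dom v'"
      then show "(0 < i \<longrightarrow> j < i) \<and> (i < 0 \<longrightarrow> i < j)"
        using A1[of i b] A1[of i j] A2[of i a] A2[of i j] ab A(1) by auto
    qed
  next
    assume b: "beyond v v'"
    let ?A1 = "{i \<in> dom v'. i < 0}" and ?A2 = "{i \<in> dom v'. 0 < i}"
    have ne: "?A1 \<noteq> {}" "?A2 \<noteq> {}" "dom v \<noteq> {}" using signs[OF assms(5)] ab by blast+
    have fin: "finite ?A1" "finite ?A2" using assms(2) by simp_all
    have "Max ?A1 \<in> ?A1" "Min ?A2 \<in> ?A2" "Min (dom v) \<in> dom v" "Max (dom v) \<in> dom v"
      using Max_in[OF fin(1) ne(1)] Min_in[OF fin(2) ne(2)] Min_in[OF assms(1) ne(3)]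
        Max_in[OF assms(1) ne(3)] by blast+
    then have "Max ?A1 < Min (dom v)" "Max (dom v) < Min ?A2" "Min (dom v) \<le> Max (dom v)"
      using b assms(1) unfolding beyond_def by auto
    moreover have "dom v' = ?A1 \<union> ?A2" using assms(3) by (auto simp: neq_iff)
    ultimately show "R1_less v v'" unfolding R1_less_def using ne by blast
  qed
qed

lemma R2_less_iff_beyond:
  assumes "finite (dom v)" "finite (dom v')" "dom v \<noteq> {}" "dom v' \<noteq> {}" "dom v' \<subseteq> {1..}"
  shows "R2_less v v' \<longleftrightarrow> beyond v v'"
proof -
  have "beyond v v' \<longleftrightarrow> (\<forall>j\<in>dom v. \<forall>i\<in>dom v'. j < i)"
    unfolding beyond_def
  proof (intro ball_cong refl)
    fix i assume "i \<in> dom v'"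
    then have "0 < i" using assms(5) by auto
    then show "(0 < i \<longrightarrow> j < i) \<and> (i < 0 \<longrightarrow> i < j) \<longleftrightarrow> j < i" for j by simp
  qed
  then show ?thesis unfolding R2_less_def
      Max_less_iff[OF assms(1,3)] Min_gr_iff[OF assms(2,4)] by blast
qed

lemma sgn_image_pos: "sgn ` D \<subseteq> {1} \<longleftrightarrow> D \<subseteq> {1..}" for D :: "int set"
  by (simp add: image_subset_iff subset_eq sgn_1_pos int_one_le_iff_zero_less)

lemma two_sided_recurrence:
  fixes \<alpha> :: "int \<Rightarrow> 'a" and X :: "'x::metric_space set"
  assumes alphabet: "alphabet_setup \<alpha> k \<upsilon>" and X: "compact X" "x \<in> X"
    and T: "system2 \<alpha> k X T" and w: "w \<in> seqs2 \<alpha> k \<upsilon>"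
  shows "\<exists>u x0. extraction2 \<alpha> k \<upsilon> u w \<and> x0 \<in> X \<and>
      R1_lim (Ext2 \<alpha> k \<upsilon> u) (\<lambda>v. T v x) x0 \<and> R1_lim (Ext2 \<alpha> k \<upsilon> u) (\<lambda>v. T v x0) x0"
proof -
  let ?P = "\<lambda>n. {1..k (int n)} \<times> {1..k (- int n)}"
  let ?L = "\<lambda>(p, q) i. if i > 0 then \<alpha> (int p) else \<alpha> (- int q)"
  have k: "1 \<le> k n" if "n \<noteq> 0" for n using alphabet that by (simp add: alphabet_setup_def)
  have k_mono: "k m \<le> k n \<and> k (- m) \<le> k (- n)" if "0 < m" "m \<le> n" for m n
    using alphabet that by (simp add: alphabet_setup_def)
  interpret word_substitution ?P \<alpha> k \<upsilon> "{1, - 1}" ?L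
  proof
    fix n :: nat assume n: "1 \<le> n"
    show "?P n \<noteq> {}" using k[of "int n"] k[of "- int n"] n by auto
    show "finite (?P n)" by simp
  next
    fix m n :: nat assume "1 \<le> m" "m \<le> n"
    then show "?P m \<subseteq> ?P n" using k_mono[of "int m" "int n"] by auto
  next
    fix n p i assume n: "1 \<le> n" "p \<in> ?P n" "int n \<le> \<bar>i\<bar>"
    obtain a b where p: "p = (a, b)" by (cases p)
    \<comment> \<open>Parameters of index \<open>n\<close> stay admissible at positions of absolute
      value at least \<open>n\<close>, as \<open>k\<close> increases weakly away from 0 on each
      side.\<close>
    show "?L p i \<in> letters_at \<alpha> k i"
    proof (cases "0 < i")
      case True
      then have "a \<le> k i" using n p k_mono[of "int n" i] by auto
      then show ?thesis using True n p by (auto simp: letters_at_def)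
    next
      case False
      then have "b \<le> k i" using n p k_mono[of "int n" "- i"] by auto
      then show ?thesis using False n p by (auto simp: letters_at_def)
    qed
  qed (use alphabet in simp_all)
  have sub_eq: "sub v c = subst2 \<alpha> \<upsilon> v c" for v c
    by (cases c) (auto simp: sub_def)
  have vws_eq: "located_vwords = vwords2 \<alpha> k \<upsilon>"
  proof -
    have "v \<in> located_vwords \<longleftrightarrow> v \<in> vwords2 \<alpha> k \<upsilon>" if "v \<in> vwords \<alpha> k \<upsilon>" for v
    proof -
      have "sgn i = 1 \<or> sgn i = - 1" if "i \<in> dom v" for i
        using that \<open>v \<in> vwords \<alpha> k \<upsilon>\<close> by (auto simp: vwords_def sgn_if)
      then have "sgn ` dom v \<subseteq> {1, - 1}" by blast
      moreover have "(\<exists>i. sgn i = 1 \<and> v i = Some \<upsilon>) \<longleftrightarrow> (\<exists>i\<in>dom_pos v. v i = Some \<upsilon>)"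
        "(\<exists>i. sgn i = - 1 \<and> v i = Some \<upsilon>) \<longleftrightarrow> (\<exists>i\<in>dom_neg v. v i = Some \<upsilon>)"
        by (auto simp: dom_pos_def dom_neg_def sgn_1_pos sgn_1_neg)
      ultimately show ?thesis using that by (auto simp: located_vwords_def vwords2_def)
    qed
    then show ?thesis by (auto simp: located_vwords_def vwords2_def)
  qed
  have less_eq: "R1_less v v' \<longleftrightarrow> beyond v v'" if "v \<in> located_vwords" "v' \<in> located_vwords" for v v'
    using that nonzero_vws finite_dom_vws sgn_dom_vws by (intro R1_less_iff_beyond) blast+
  have seqs_eq: "vseqs = seqs2 \<alpha> k \<upsilon>"
    unfolding vseqs_def seqs2_def vws_eq[symmetric]
  proof (intro Collect_cong)
    fix w :: "nat \<Rightarrow> 'a word_map"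
    have "beyond (w n) (w (Suc n)) \<longleftrightarrow> R1_less (w n) (w (Suc n))" if "\<forall>n\<ge>1. w n \<in> located_vwords" "1 \<le> n" for n
      using that by (simp add: less_eq)
    then show "(\<forall>n\<ge>1. w n \<in> located_vwords \<and> beyond (w n) (w (Suc n))) \<longleftrightarrow>
        (\<forall>n\<ge>1. w n \<in> located_vwords \<and> R1_less (w n) (w (Suc n)))" by blast
  qed
  have Ext_eq: "Ext_from 1 u = Ext2 \<alpha> k \<upsilon> u" and ExtV_eq: "ExtV u = ExtV2 \<alpha> k \<upsilon> u" for u
    unfolding Ext_from_def Ext2_def ExtV_def ExtV2_def sub_prod_def sub_eq params2_def by simp_all
  have Tc: "continuous_on X (T v) \<and> T v ` X \<subseteq> X" if "v \<in> located_words" for v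
    using T that by (simp add: system2_def located_words_def)
  have TT: "T v (T v' y) = T (v ++ v') y"
    if "v \<in> located_words" "v' \<in> located_words" "beyond v v'" "y \<in> X" for v v' y
  proof -
    have "R1_less v v'"
      using that by (subst R1_less_iff_beyond) (auto simp: located_words_def words2_def)
    then show ?thesis using T that by (simp add: system2_def located_words_def)
  qed
  obtain u x0 where u: "u \<in> vseqs" "\<And>n. 1 \<le> n \<Longrightarrow> u n \<in> ExtV w" and x0: "x0 \<in> X"
    and lim: "\<And>y V. \<lbrakk>y = x \<or> y = x0; open V; x0 \<in> V\<rbrakk> \<Longrightarrow> \<exists>n0\<ge>1::nat. \<forall>v\<in>Ext_from 1 u.
       (\<forall>i\<in>dom v. 0 < i \<longrightarrow> int n0 \<le> i) \<longrightarrow> T v y \<in> V"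
    by (rule recurrent_extraction[OF X w[folded seqs_eq] Tc TT]) blast+
  have "R1_lim (Ext2 \<alpha> k \<upsilon> u) (\<lambda>v. T v y) x0" if y: "y = x \<or> y = x0" for y
    unfolding R1_lim_def
  proof (intro allI impI, elim conjE)
    fix V assume V: "open V" "x0 \<in> V"
    obtain n0 :: nat where n0: "n0 \<ge> 1" "\<And>v. \<lbrakk>v \<in> Ext_from 1 u; \<forall>i\<in>dom v. 0 < i \<longrightarrow> int n0 \<le> i\<rbrakk> \<Longrightarrow> T v y \<in> V"
      using lim[OF y V] by blast
    have "T v y \<in> V"
      if v: "v \<in> Ext2 \<alpha> k \<upsilon> u" "int n0 \<le> min (- Max (dom_neg v)) (Min (dom_pos v))" for v
    proof (rule n0(2))
      show v1: "v \<in> Ext_from 1 u" using v(1) by (simp only: Ext_eq)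
      have fin: "finite (dom_pos v)" using finite_dom_Ext_from[OF u(1) v1] by (simp add: dom_pos_def)
      show "\<forall>i\<in>dom v. 0 < i \<longrightarrow> int n0 \<le> i"
      proof (intro ballI impI)
        fix i :: int assume "i \<in> dom v" "0 < i"
        then have "Min (dom_pos v) \<le> i" by (intro Min_le[OF fin]) (simp add: dom_pos_def)
        with v(2) show "int n0 \<le> i" by linarith
      qed
    qed
    with n0(1) show "\<exists>n0\<ge>1::nat. \<forall>v\<in>Ext2 \<alpha> k \<upsilon> u.
        int n0 \<le> min (- Max (dom_neg v)) (Min (dom_pos v)) \<longrightarrow> T v y \<in> V" by blast
  qed
  moreover have "extraction2 \<alpha> k \<upsilon> u w"
    using u unfolding extraction2_def seqs_eq ExtV_eq by blast
  ultimately show ?thesis using x0 by blast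
qed

lemma one_sided_recurrence:
  fixes \<alpha> :: "int \<Rightarrow> 'a" and X :: "'x::metric_space set"
  assumes alphabet: "alphabet_setup \<alpha> k \<upsilon>" and X: "compact X" "x \<in> X"
    and T: "system1 \<alpha> k X T" and w: "w \<in> seqs1 \<alpha> k \<upsilon>"
  shows "\<exists>u x0. extraction1 \<alpha> k \<upsilon> u w \<and> x0 \<in> X \<and>
      R2_lim (Ext1 \<alpha> k \<upsilon> u) (\<lambda>v. T v x) x0 \<and> R2_lim (Ext1 \<alpha> k \<upsilon> u) (\<lambda>v. T v x0) x0"
proof -
  let ?P = "\<lambda>n. {1..k (int n)}"
  let ?L = "\<lambda>p i :: int. \<alpha> (int p)"
  have k: "1 \<le> k n" if "n \<noteq> 0" for n using alphabet that by (simp add: alphabet_setup_def)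
  have k_mono: "k m \<le> k n" if "0 < m" "m \<le> n" for m n
    using alphabet that by (simp add: alphabet_setup_def)
  interpret word_substitution ?P \<alpha> k \<upsilon> "{1}" ?L
  proof
    fix n :: nat assume n: "1 \<le> n"
    show "?P n \<noteq> {}" using k[of "int n"] n by auto
    show "finite (?P n)" by simp
  next
    fix m n :: nat assume "1 \<le> m" "m \<le> n"
    then show "?P m \<subseteq> ?P n" using k_mono[of "int m" "int n"] by auto
  next
    fix n p i assume n: "1 \<le> n" "p \<in> ?P n" "int n \<le> \<bar>i\<bar>" "sgn i \<in> {1 :: int}"
    then have "0 < i" by (simp add: sgn_1_pos)
    moreover from this have "p \<le> k i" using n k_mono[of "int n" i] by auto
    ultimately show "\<alpha> (int p) \<in> letters_at \<alpha> k i" using n by (auto simp: letters_at_def)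
  qed (use alphabet in simp_all)
  have sub_eq: "sub v c = subst1 \<alpha> \<upsilon> v c" for v c
    by (cases c) (auto simp: sub_def)
  have vws_eq: "located_vwords = vwords1 \<alpha> k \<upsilon>"
  proof -
    \<comment> \<open>On one side, a variable attained anywhere is attained at the only
      sign.\<close>
    have "\<exists>i. sgn i = 1 \<and> v i = Some \<upsilon>" if v: "v \<in> vwords \<alpha> k \<upsilon>" "sgn ` dom v \<subseteq> {1}" for v
    proof -
      obtain i where "v i = Some \<upsilon>" using v(1) by (auto simp: vwords_def ran_def)
      then show ?thesis using v(2) by blast
    qed
    then show ?thesis unfolding located_vwords_def vwords1_def sgn_image_pos[symmetric] by blast
  qed
  have pos: "dom v \<subseteq> {1..}" "dom v \<noteq> {}" if "sgn ` dom v = {1}" for v :: "'a word_map"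
    using that sgn_image_pos[of "dom v"] by auto
  have less_eq: "R2_less v v' \<longleftrightarrow> beyond v v'" if "v \<in> located_vwords" "v' \<in> located_vwords" for v v'
    using that finite_dom_vws pos[OF sgn_dom_vws] by (intro R2_less_iff_beyond) blast+
  have seqs_eq: "vseqs = seqs1 \<alpha> k \<upsilon>"
    unfolding vseqs_def seqs1_def vws_eq[symmetric]
  proof (intro Collect_cong)
    fix w :: "nat \<Rightarrow> 'a word_map"
    have "beyond (w n) (w (Suc n)) \<longleftrightarrow> R2_less (w n) (w (Suc n))" if "\<forall>n\<ge>1. w n \<in> located_vwords" "1 \<le> n" for n
      using that by (simp add: less_eq)
    then show "(\<forall>n\<ge>1. w n \<in> located_vwords \<and> beyond (w n) (w (Suc n))) \<longleftrightarrow>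
        (\<forall>n\<ge>1. w n \<in> located_vwords \<and> R2_less (w n) (w (Suc n)))" by blast
  qed
  have Ext_eq: "Ext_from 1 u = Ext1 \<alpha> k \<upsilon> u" and ExtV_eq: "ExtV u = ExtV1 \<alpha> k \<upsilon> u" for u
    unfolding Ext_from_def Ext1_def ExtV_def ExtV1_def sub_prod_def sub_eq params1_def by simp_all
  have cw1: "v \<in> words1 \<alpha> k" if "v \<in> located_words" for v
    using that pos by (simp add: located_words_def words1_def)
  have Tc: "continuous_on X (T v) \<and> T v ` X \<subseteq> X" if "v \<in> located_words" for v
    using T cw1[OF that] by (simp add: system1_def)
  have TT: "T v (T v' y) = T (v ++ v') y"
    if "v \<in> located_words" "v' \<in> located_words" "beyond v v'" "y \<in> X" for v v' y
  proof -
    have "R2_less v v'"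
      using that pos by (subst R2_less_iff_beyond) (auto simp: located_words_def words2_def)
    then show ?thesis using T cw1 that by (simp add: system1_def)
  qed
  obtain u x0 where u: "u \<in> vseqs" "\<And>n. 1 \<le> n \<Longrightarrow> u n \<in> ExtV w" and x0: "x0 \<in> X"
    and lim: "\<And>y V. \<lbrakk>y = x \<or> y = x0; open V; x0 \<in> V\<rbrakk> \<Longrightarrow> \<exists>n0\<ge>1::nat. \<forall>v\<in>Ext_from 1 u.
       (\<forall>i\<in>dom v. 0 < i \<longrightarrow> int n0 \<le> i) \<longrightarrow> T v y \<in> V"
    by (rule recurrent_extraction[OF X w[folded seqs_eq] Tc TT]) blast+
  have "R2_lim (Ext1 \<alpha> k \<upsilon> u) (\<lambda>v. T v y) x0" if y: "y = x \<or> y = x0" for y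
    unfolding R2_lim_def
  proof (intro allI impI, elim conjE)
    fix V assume V: "open V" "x0 \<in> V"
    obtain n0 :: nat where n0: "n0 \<ge> 1" "\<And>v. \<lbrakk>v \<in> Ext_from 1 u; \<forall>i\<in>dom v. 0 < i \<longrightarrow> int n0 \<le> i\<rbrakk> \<Longrightarrow> T v y \<in> V"
      using lim[OF y V] by blast
    have "T v y \<in> V" if v: "v \<in> Ext1 \<alpha> k \<upsilon> u" "int n0 \<le> Min (dom v)" for v
    proof (rule n0(2))
      show v1: "v \<in> Ext_from 1 u" using v(1) by (simp only: Ext_eq)
      show "\<forall>i\<in>dom v. 0 < i \<longrightarrow> int n0 \<le> i"
        using Min_le[OF finite_dom_Ext_from[OF u(1) v1]] v(2) order_trans by blast
    qed
    with n0(1) show "\<exists>n0\<ge>1::nat. \<forall>v\<in>Ext1 \<alpha> k \<upsilon> u. int n0 \<le> Min (dom v) \<longrightarrow> T v y \<in> V" by blast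
  qed
  moreover have "extraction1 \<alpha> k \<upsilon> u w"
    using u unfolding extraction1_def seqs_eq ExtV_eq by blast
  ultimately show ?thesis using x0 by blast
qed

theorem theorem2p6:
  fixes \<alpha> :: "int \<Rightarrow> 'a" and k :: "int \<Rightarrow> nat" and \<upsilon> :: 'a
    and X :: "'x::metric_space set" and x :: 'x
  assumes "alphabet_setup \<alpha> k \<upsilon>"
    and "compact X" and "x \<in> X"
  shows "(\<forall>T w. system2 \<alpha> k X T \<and> w \<in> seqs2 \<alpha> k \<upsilon> \<longrightarrow>
           (\<exists>u x0. extraction2 \<alpha> k \<upsilon> u w \<and> x0 \<in> X \<and>
              R1_lim (Ext2 \<alpha> k \<upsilon> u) (\<lambda>v. T v x) x0 \<and>
              R1_lim (Ext2 \<alpha> k \<upsilon> u) (\<lambda>v. T v x0) x0)) \<and>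
         (\<forall>T w. system1 \<alpha> k X T \<and> w \<in> seqs1 \<alpha> k \<upsilon> \<longrightarrow>
           (\<exists>u x0. extraction1 \<alpha> k \<upsilon> u w \<and> x0 \<in> X \<and>
              R2_lim (Ext1 \<alpha> k \<upsilon> u) (\<lambda>v. T v x) x0 \<and>
              R2_lim (Ext1 \<alpha> k \<upsilon> u) (\<lambda>v. T v x0) x0))"
proof (intro conjI allI impI; elim conjE)
  fix T and w assume "system2 \<alpha> k X T" "w \<in> seqs2 \<alpha> k \<upsilon>"
  then show "\<exists>u x0. extraction2 \<alpha> k \<upsilon> u w \<and> x0 \<in> X \<and>
      R1_lim (Ext2 \<alpha> k \<upsilon> u) (\<lambda>v. T v x) x0 \<and> R1_lim (Ext2 \<alpha> k \<upsilon> u) (\<lambda>v. T v x0) x0"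
    by (rule two_sided_recurrence[OF assms])
next
  fix T and w assume "system1 \<alpha> k X T" "w \<in> seqs1 \<alpha> k \<upsilon>"
  then show "\<exists>u x0. extraction1 \<alpha> k \<upsilon> u w \<and> x0 \<in> X \<and>
      R2_lim (Ext1 \<alpha> k \<upsilon> u) (\<lambda>v. T v x) x0 \<and> R2_lim (Ext1 \<alpha> k \<upsilon> u) (\<lambda>v. T v x0) x0"
    by (rule one_sided_recurrence[OF assms])
qed

end
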